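(* Consider the vehicle-service model and the NRPS policy described in the context, with control parameters $\rho\in(0,\infty)$ and $\eta\in(0,\tfrac12)$. There exists a function $\Phi_1(\rho,\eta)$ (not depending on $d$) such that (i) $\Phi_1(\rho,\eta)$ is finite and positive for all $\rho\in(0,\infty)$ and $\eta\in(0,\tfrac12)$; and (ii) for all $d\ge 5$ and all links $(i,j)$, $i\neq j$, $$\mathbb{E}\left\{\|\hat{\boldsymbol\theta}_{ij}^{d-1}-\boldsymbol\theta_{ij}\|_2^2\right\}<\Phi_1(\rho,\eta)\,\frac{\ln(d-1)}{(d-1)^{1-2\eta}}.$$ Consequently, for all links $(i,j)$, $\mathbb{E}\{\|\hat{\boldsymbol\theta}_{ij}^{d-1}-\boldsymbol\theta_{ij}\|_2^2\}\to 0$ as $d\to\infty$. (The expectation is over the demand shocks and the randomness of the policy.)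
   Context: Model. There are locations $\mathcal N=\{1,\dots,N\}$ and days $d=1,\dots,D$. For each ordered pair (link) $(i,j)$, $i\neq j$, there are unknown parameters $\boldsymbol\theta_{ij}=(\alpha_{ij},\beta_{ij})$ with $0<\alpha_{\min}\le\alpha_{ij}\le\alpha_{\max}$ and $0<\beta_{\min}\le\beta_{ij}\le\beta_{\max}$ (only the bounds $\alpha_{\min},\alpha_{\max},\beta_{\min},\beta_{\max}$ are known to the provider), a travel time $\xi_{ij}>0$, and demand shocks $\epsilon_{ij}^d\in[\underline\epsilon,\overline\epsilon]$; for each link, $\{\epsilon_{ij}^d\}_{d=1,\dots,D}$ are i.i.d. with known c.d.f. $F_{ij}$ and $\mathbb{E}\{\epsilon_{ij}^d\}=0$. There is a maximum price $p_{\max}$ and a per-slot vehicle cost $c$ with $0<c<p_{\max}$, and it is assumed that $\alpha_{\min}-\beta_{\max}p_{\max}+\underline\epsilon\ge 0$. On day $d$ the provider chooses prices $p_{ij}^d\le p_{\max}$ and supplies $w_{ij}^d\ge0$ satisfying flow balance $\sum_{j\neq i}w_{ij}^d=\sum_{j\neq i}w_{ji}^d$ for all $i$; the realized demand $\Psi_{ij}^d=\alpha_{ij}-\beta_{ij}p_{ij}^d+\epsilon_{ij}^d$ is then observed for every link. Least-squares estimate. For $t\ge1$ and each link, let $\tilde{\boldsymbol\theta}_{ij}^{t}=(\tilde\alpha_{ij}^t,\tilde\beta_{ij}^t)$ minimize over $(\bar\alpha,\bar\beta)\in\mathbb R^2$ the quantity $\sum_{\tau=1}^{t}\big(\Psi_{ij}^\tau-(\bar\alpha-\bar\beta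 p_{ij}^\tau)\big)^2$, and let $\hat{\boldsymbol\theta}_{ij}^{t}=(\hat\alpha_{ij}^t,\hat\beta_{ij}^t)$ with $\hat\alpha_{ij}^t=\max\{\min\{\tilde\alpha_{ij}^t,\alpha_{\max}\},\alpha_{\min}\}$ and $\hat\beta_{ij}^t=\max\{\min\{\tilde\beta_{ij}^t,\beta_{\max}\},\beta_{\min}\}$. $\hat{\boldsymbol\theta}^{t}$ denotes the vector over all links. Estimated optimization problem. For an estimate $\hat{\boldsymbol\theta}=(\hat\alpha_{ij},\hat\beta_{ij})_{i\neq j}$, let $(\mathbf p^*(\hat{\boldsymbol\theta}),\mathbf w^*(\hat{\boldsymbol\theta}))$ denote an optimal solution of: maximize $\sum_{i}\sum_{j\neq i}\xi_{ij}\,\mathbb{E}_{\epsilon_{ij}}\{\min\{\hat\alpha_{ij}-\hat\beta_{ij}p_{ij}+\epsilon_{ij},w_{ij}\}\}\,p_{ij}-\sum_i\sum_{j\neq i}\xi_{ij}w_{ij}c$ subject to $\sum_{j\neq i}w_{ij}=\sum_{j\neq i}w_{ji}$ for all $i$, $w_{ij}=\hat\alpha_{ij}-\hat\beta_{ij}p_{ij}$, $p_{ij}\le p_{\max}$, $w_{ij}\ge0$ for all links. NRPS policy. Initialization: for each link, $\hat{\boldsymbol\theta}_{ij}^0$ is drawn from $[\alpha_{\min},\alpha_{\max}]\times[\beta_{\min},\beta_{\max}]$ according to an arbitrary distribution; choose $\rho\in(0,\infty)$, $\eta\in(0,\frac12)$. On each odd day $d$: compute $\hat{\boldsymbol\theta}^{d-1}$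 (the least-squares estimate above for $d\ge3$; the initial draw for $d=1$) and implement $p_{ij}^d=p_{ij}^*(\hat{\boldsymbol\theta}^{d-1})$, $w_{ij}^d=w_{ij}^*(\hat{\boldsymbol\theta}^{d-1})$. On each even day $d$: implement $p_{ij}^d=p_{ij}^*(\hat{\boldsymbol\theta}^{d-2})-\frac{\rho}{\hat\beta_{ij}^{d-2}}d^{-\eta}$ and $w_{ij}^d=w_{ij}^*(\hat{\boldsymbol\theta}^{d-2})+\rho d^{-\eta}$. *)

theory Defs
  imports "HOL-Probability.Probability"
begin

definition links :: "('loc \<times> 'loc) set" where
  "links = {(i, j). i \<noteq> j}"

definition clip :: "real \<Rightarrow> real \<Rightarrow> real \<Rightarrow> real" where
  "clip lo hi x = max (min x hi) lo"

definition lsq_err :: "(nat \<Rightarrow> real) \<Rightarrow> (nat \<Rightarrow> real) \<Rightarrow> nat \<Rightarrow> real \<times> real \<Rightarrow> real" where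
  "lsq_err p Psi t ab = (\<Sum>\<tau>=1..t. (Psi \<tau> - (fst ab - snd ab * p \<tau>))\<^sup>2)"

definition ls_raw :: "(nat \<Rightarrow> real) \<Rightarrow> (nat \<Rightarrow> real) \<Rightarrow> nat \<Rightarrow> real \<times> real" where
  "ls_raw p Psi t = (SOME ab. \<forall>ab'. lsq_err p Psi t ab \<le> lsq_err p Psi t ab')"

text \<open>The estimate hat-theta^t of one link, given the true parameter th = (alpha, beta),
  the initial draw th0, the price history p and the shock history e of that link.
  For t >= 1: clipped least squares over days 1..t on the observed demands
  Psi tau = alpha - beta * p tau + e tau.\<close>
definition est_link ::
  "real \<Rightarrow> real \<Rightarrow> real \<Rightarrow> real \<Rightarrow> real \<times> real \<Rightarrow> real \<times> real
    \<Rightarrow> (nat \<Rightarrow> real) \<Rightarrow> (nat \<Rightarrow> real) \<Rightarrow> nat \<Rightarrow> real \<times> real" where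
  "est_link amin amax bmin bmax th th0 p e t =
     (if t = 0 then th0
      else (let ab = ls_raw p (\<lambda>\<tau>. fst th - snd th * p \<tau> + e \<tau>) t
            in (clip amin amax (fst ab), clip bmin bmax (snd ab))))"

definition feasible ::
  "real \<Rightarrow> ('loc \<times> 'loc \<Rightarrow> real \<times> real) \<Rightarrow> ('loc \<times> 'loc \<Rightarrow> real) \<Rightarrow> ('loc \<times> 'loc \<Rightarrow> real) \<Rightarrow> bool" where
  "feasible pmax thh p w \<longleftrightarrow>
     (\<forall>i. (\<Sum>j\<in>{j. j \<noteq> i}. w (i, j)) = (\<Sum>j\<in>{j. j \<noteq> i}. w (j, i))) \<and>
     (\<forall>l\<in>links. w l = fst (thh l) - snd (thh l) * p l \<and> p l \<le> pmax \<and> 0 \<le> w l)"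

text \<open>Objective of the estimated problem; D l is the distribution of the shock of link l.\<close>
definition objective ::
  "('loc \<times> 'loc \<Rightarrow> real) \<Rightarrow> real \<Rightarrow> ('loc \<times> 'loc \<Rightarrow> real measure)
    \<Rightarrow> ('loc \<times> 'loc \<Rightarrow> real \<times> real) \<Rightarrow> ('loc \<times> 'loc \<Rightarrow> real) \<Rightarrow> ('loc \<times> 'loc \<Rightarrow> real) \<Rightarrow> real" where
  "objective xi c D thh p w =
     (\<Sum>l\<in>links. xi l * (\<integral>e. min (fst (thh l) - snd (thh l) * p l + e) (w l) \<partial>(D l)) * p l)
     - (\<Sum>l\<in>links. xi l * w l * c)"

definition optimal ::
  "('loc \<times> 'loc \<Rightarrow> real) \<Rightarrow> real \<Rightarrow> real \<Rightarrow> ('loc \<times> 'loc \<Rightarrow> real measure)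
    \<Rightarrow> ('loc \<times> 'loc \<Rightarrow> real \<times> real) \<Rightarrow> ('loc \<times> 'loc \<Rightarrow> real) \<Rightarrow> ('loc \<times> 'loc \<Rightarrow> real) \<Rightarrow> bool" where
  "optimal xi c pmax D thh p w \<longleftrightarrow>
     feasible pmax thh p w \<and>
     (\<forall>p' w'. feasible pmax thh p' w' \<longrightarrow> objective xi c D thh p' w' \<le> objective xi c D thh p w)"

text \<open>The estimate hat-theta^t (as a function of the sample point omega), on all links, given the
  realised price process P (P d omega l = price of link l on day d) and shocks eps d l omega.\<close>
definition nrps_est ::
  "real \<Rightarrow> real \<Rightarrow> real \<Rightarrow> real \<Rightarrow> ('loc \<times> 'loc \<Rightarrow> real \<times> real) \<Rightarrow> ('a \<Rightarrow> 'loc \<times> 'loc \<Rightarrow> real \<times> real)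
    \<Rightarrow> (nat \<Rightarrow> 'loc \<times> 'loc \<Rightarrow> 'a \<Rightarrow> real) \<Rightarrow> (nat \<Rightarrow> 'a \<Rightarrow> 'loc \<times> 'loc \<Rightarrow> real)
    \<Rightarrow> nat \<Rightarrow> 'a \<Rightarrow> 'loc \<times> 'loc \<Rightarrow> real \<times> real" where
  "nrps_est amin amax bmin bmax theta theta0 eps P t \<omega> =
     restrict (\<lambda>l. est_link amin amax bmin bmax (theta l) (theta0 \<omega> l)
                     (\<lambda>\<tau>. P \<tau> \<omega> l) (\<lambda>\<tau>. eps \<tau> l \<omega>) t) links"

text \<open>The price/supply processes P, W are those generated by the NRPS policy with parameters
  rho, eta and the optimal-solution selection (popt, wopt).\<close>
definition nrps_policy ::
  "'a measure \<Rightarrow> real \<Rightarrow> real \<Rightarrow> real \<Rightarrow> real \<Rightarrow> ('loc \<times> 'loc \<Rightarrow> real \<times> real) \<Rightarrow> ('a \<Rightarrow> 'loc \<times> 'loc \<Rightarrow> real \<times> real)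
    \<Rightarrow> (nat \<Rightarrow> 'loc \<times> 'loc \<Rightarrow> 'a \<Rightarrow> real)
    \<Rightarrow> (('loc \<times> 'loc \<Rightarrow> real \<times> real) \<Rightarrow> 'loc \<times> 'loc \<Rightarrow> real)
    \<Rightarrow> (('loc \<times> 'loc \<Rightarrow> real \<times> real) \<Rightarrow> 'loc \<times> 'loc \<Rightarrow> real)
    \<Rightarrow> real \<Rightarrow> real \<Rightarrow> (nat \<Rightarrow> 'a \<Rightarrow> 'loc \<times> 'loc \<Rightarrow> real) \<Rightarrow> (nat \<Rightarrow> 'a \<Rightarrow> 'loc \<times> 'loc \<Rightarrow> real) \<Rightarrow> bool" where
  "nrps_policy M amin amax bmin bmax theta theta0 eps popt wopt rho eta P W \<longleftrightarrow>
     (\<forall>\<omega>\<in>space M. \<forall>d\<ge>1. \<forall>l\<in>links.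
        (odd d \<longrightarrow>
           P d \<omega> l = popt (nrps_est amin amax bmin bmax theta theta0 eps P (d - 1) \<omega>) l \<and>
           W d \<omega> l = wopt (nrps_est amin amax bmin bmax theta theta0 eps P (d - 1) \<omega>) l) \<and>
        (even d \<longrightarrow>
           P d \<omega> l = popt (nrps_est amin amax bmin bmax theta theta0 eps P (d - 2) \<omega>) l
                      - rho / snd (nrps_est amin amax bmin bmax theta theta0 eps P (d - 2) \<omega> l)
                        * real d powr (- eta) \<and>
           W d \<omega> l = wopt (nrps_est amin amax bmin bmax theta theta0 eps P (d - 2) \<omega>) l
                      + rho * real d powr (- eta)))"

end

theory Submission
  imports Defs
begin

text \<open>
  On each pair of days \<open>2k-1\<close>, \<open>2k\<close> the two prices of a link differ by at least a multiple of
  \<open>(2k) powr -\<eta>\<close>, so the design of the regression up to day \<open>t\<close> has least eigenvalue of order at least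
  \<open>t powr (1 - 2\<eta>)\<close>, surely; this uses that optimal prices are bounded. Hence the squared error of the
  estimate is at most a constant times \<open>S\<^sup>T A\<^sup>-\<^sup>1 S / t powr (1 - 2\<eta>)\<close>, where \<open>A\<close> is the regularised
  design matrix and \<open>S\<close> the sum of the shocks weighted by the regressors. One more day increases
  \<open>S\<^sup>T A\<^sup>-\<^sup>1 S\<close> by at most a term linear in the new shock, whose mean vanishes because prices only depend
  on the past, plus the squared shock times the increase of \<open>ln (det A)\<close>. Telescoping,
  the expectation of \<open>S\<^sup>T A\<^sup>-\<^sup>1 S\<close> is of the order of \<open>ln (det A)\<close>, that is, of \<open>ln t\<close>.
\<close>

section \<open>Self-normalised sums in two dimensions\<close>

text \<open>The forced price gaps hold at every sample point, so the lower bound on the design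
  involves no probability and all randomness is left in \<open>S\<close>. The obstacle sits there:
  prices depend on earlier shocks, so given the design the vector \<open>S\<close> need not have
  mean zero, and the classical variance formula for least squares fails. The self-normalised form
  survives this feedback, because its recursion only needs each new shock to have mean zero against
  the past; the logarithm in the rate is what this costs. The identity in \<open>A\<close> is
  harmless: the unregularised design already dominates a fixed multiple of the identity, so adding
  it changes the bound by a constant factor only. One optimisation problem sets the prices of all
  links at once, so the price of a single link depends on the shocks of every link. The past must
  therefore collect all links, although each regression concerns only one.\<close>

definition ridge_det :: "(nat \<Rightarrow> real) \<Rightarrow> nat \<Rightarrow> real" where
  "ridge_det p t = (1 + real t) * (1 + (\<Sum>\<tau>=1..t. (p \<tau>)\<^sup>2)) - (\<Sum>\<tau>=1..t. p \<tau>)\<^sup>2"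

text \<open>With \<open>x \<tau> = (1, p \<tau>)\<close>, \<open>A = I + (\<Sum>\<tau>=1..t. x \<tau> x \<tau>\<^sup>T)\<close> and
  \<open>S = (\<Sum>\<tau>=1..t. e \<tau> x \<tau>)\<close>, the ridge determinant is \<open>det A\<close> and the ridge energy is
  \<open>S\<^sup>T A\<^sup>-\<^sup>1 S\<close>. The identity in \<open>A\<close> keeps everything defined from \<open>t = 0\<close> on.\<close>

definition ridge_energy :: "(nat \<Rightarrow> real) \<Rightarrow> (nat \<Rightarrow> real) \<Rightarrow> nat \<Rightarrow> real" where
  "ridge_energy p e t =
     ((1 + (\<Sum>\<tau>=1..t. (p \<tau>)\<^sup>2)) * (\<Sum>\<tau>=1..t. e \<tau>)\<^sup>2
      - 2 * (\<Sum>\<tau>=1..t. p \<tau>) * (\<Sum>\<tau>=1..t. e \<tau>) * (\<Sum>\<tau>=1..t. p \<tau> * e \<tau>)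
      + (1 + real t) * (\<Sum>\<tau>=1..t. p \<tau> * e \<tau>)\<^sup>2) / ridge_det p t"

text \<open>The predictable coefficient \<open>x\<^sup>T A\<^sup>-\<^sup>1 S\<close> of the new shock in the one-step expansion of the
  energy: here \<open>x\<close> and \<open>A\<close> are taken at time \<open>Suc t\<close>, but \<open>S\<close> at time \<open>t\<close>.\<close>

definition ridge_cross :: "(nat \<Rightarrow> real) \<Rightarrow> (nat \<Rightarrow> real) \<Rightarrow> nat \<Rightarrow> real" where
  "ridge_cross p e t =
     ((1 + (\<Sum>\<tau>=1..Suc t. (p \<tau>)\<^sup>2) - p (Suc t) * (\<Sum>\<tau>=1..Suc t. p \<tau>)) * (\<Sum>\<tau>=1..t. e \<tau>)
      + ((1 + real (Suc t)) * p (Suc t) - (\<Sum>\<tau>=1..Suc t. p \<tau>)) * (\<Sum>\<tau>=1..t. p \<tau> * e \<tau>))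
     / ridge_det p (Suc t)"

text \<open>Multiplying by \<open>a\<close> and completing the square leaves the determinant as the
  coefficient of the square of \<open>y\<close>.\<close>

lemma quadratic_form_ge:
  fixes a b c x y :: real
  assumes "0 < a" "0 \<le> a * c - b\<^sup>2"
  shows "0 \<le> a * x\<^sup>2 + 2 * b * x * y + c * y\<^sup>2"
proof -
  have "0 \<le> (a * x + b * y)\<^sup>2 + (a * c - b\<^sup>2) * y\<^sup>2"
    using assms by simp
  also have "\<dots> = a * (a * x\<^sup>2 + 2 * b * x * y + c * y\<^sup>2)"
    by (simp add: power2_eq_square algebra_simps)
  finally show ?thesis using assms(1) by (simp add: zero_le_mult_iff)
qed

text \<open>Matrix determinant lemma: \<open>det (A + x x^T) = det A + x^T adj(A) x\<close> at
  \<open>x = (1, p (Suc t))\<close>.\<close>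

lemma ridge_det_Suc:
  "ridge_det p (Suc t) = ridge_det p t
     + ((1 + (\<Sum>\<tau>=1..t. (p \<tau>)\<^sup>2)) - 2 * (\<Sum>\<tau>=1..t. p \<tau>) * p (Suc t) + (1 + real t) * (p (Suc t))\<^sup>2)"
  by (simp add: ridge_det_def power2_eq_square algebra_simps)

text \<open>The two claims need each other: the increment is nonnegative because the adjugate is
  positive semidefinite, which requires a nonnegative determinant, and this in turn comes from
  monotonicity in the previous step.\<close>

lemma ridge_det_mono_ge_1: "ridge_det p t \<le> ridge_det p (Suc t) \<and> 1 \<le> ridge_det p t"
proof (induction t)
  case 0
  then show ?case by (simp add: ridge_det_def power2_eq_square algebra_simps)
next
  case (Suc t)
  have *: "1 \<le> ridge_det p (Suc t)" using Suc by linarith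
  have "0 \<le> (1 + real (Suc t)) * (p (Suc (Suc t)))\<^sup>2
      + 2 * (- (\<Sum>\<tau>=1..Suc t. p \<tau>)) * p (Suc (Suc t)) * 1
      + (1 + (\<Sum>\<tau>=1..Suc t. (p \<tau>)\<^sup>2)) * 1\<^sup>2"
  proof (rule quadratic_form_ge)
    show "0 \<le> (1 + real (Suc t)) * (1 + (\<Sum>\<tau>=1..Suc t. (p \<tau>)\<^sup>2)) - (- (\<Sum>\<tau>=1..Suc t. p \<tau>))\<^sup>2"
      using * unfolding ridge_det_def power2_minus by linarith
  qed simp
  then show ?case using * ridge_det_Suc[of p "Suc t"] by (simp add: algebra_simps)
qed

lemmas ridge_det_ge_1 = ridge_det_mono_ge_1[THEN conjunct2]
lemmas ridge_det_mono = ridge_det_mono_ge_1[THEN conjunct1]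

lemma ridge_energy_0 [simp]: "ridge_energy p e 0 = 0"
  by (simp add: ridge_energy_def)

text \<open>As \<open>A\<close> is positive definite, the energy is the maximum over
  \<open>h = (z, y)\<close> of \<open>2 h^T S - h^T A h\<close>, attained at \<open>A^-1 S\<close>.
  Any trial vector thus bounds the energy from below; the estimation error will be one.\<close>

lemma ridge_energy_variational:
  "2 * (z * (\<Sum>\<tau>=1..t. e \<tau>) + y * (\<Sum>\<tau>=1..t. p \<tau> * e \<tau>))
     - ((\<Sum>\<tau>=1..t. (z + y * p \<tau>)\<^sup>2) + z\<^sup>2 + y\<^sup>2) \<le> ridge_energy p e t"
proof -
  define a b c u v \<Delta> where defs: "a = 1 + real t" "b = (\<Sum>\<tau>=1..t. p \<tau>)" "c = 1 + (\<Sum>\<tau>=1..t. (p \<tau>)\<^sup>2)"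
    "u = (\<Sum>\<tau>=1..t. e \<tau>)" "v = (\<Sum>\<tau>=1..t. p \<tau> * e \<tau>)" "\<Delta> = ridge_det p t"
  have \<Delta>: "\<Delta> = a * c - b\<^sup>2" "\<Delta> \<ge> 1"
    using ridge_det_ge_1[of p t] by (auto simp: defs ridge_det_def)
  have a: "a > 0" by (simp add: defs)
  have sq: "(\<Sum>\<tau>=1..t. (z + y * p \<tau>)\<^sup>2) + z\<^sup>2 + y\<^sup>2 = a * z\<^sup>2 + 2 * b * z * y + c * y\<^sup>2"
    by (simp add: defs power2_eq_square algebra_simps sum.distrib sum_distrib_left sum_distrib_right)
  txt \<open>The residual of the regularised normal equations, scaled by the determinant.\<close>
  have "0 \<le> a * (\<Delta> * z - (c * u - b * v))\<^sup>2
     + 2 * b * (\<Delta> * z - (c * u - b * v)) * (\<Delta> * y - (a * v - b * u)) + c * (\<Delta> * y - (a * v - b * u))\<^sup>2"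
    using a \<Delta> by (intro quadratic_form_ge) auto
  also have "\<dots> = \<Delta> * (\<Delta> * (a * z\<^sup>2 + 2 * b * z * y + c * y\<^sup>2 - 2 * (z * u + y * v))
      + (c * u\<^sup>2 - 2 * b * u * v + a * v\<^sup>2))"
    unfolding \<Delta>(1) by algebra
  finally have "0 \<le> \<Delta> * (a * z\<^sup>2 + 2 * b * z * y + c * y\<^sup>2 - 2 * (z * u + y * v))
      + (c * u\<^sup>2 - 2 * b * u * v + a * v\<^sup>2)"
    using \<Delta>(2) by (simp add: zero_le_mult_iff)
  then have "2 * (z * u + y * v) - (a * z\<^sup>2 + 2 * b * z * y + c * y\<^sup>2)
     \<le> (c * u\<^sup>2 - 2 * b * u * v + a * v\<^sup>2) / \<Delta>"
    using \<Delta>(2) by (simp add: field_simps)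
  then show ?thesis
    unfolding sq[symmetric] unfolding defs ridge_energy_def .
qed

lemma ridge_energy_nonneg: "0 \<le> ridge_energy p e t"
  using ridge_energy_variational[of 0 e t 0 p] by simp

text \<open>With \<open>A' = A + x x^T\<close> and \<open>S' = S + e x\<close>, the new energy is
  \<open>S^T A'^-1 S + 2 e x^T A'^-1 S + e^2 x^T A'^-1 x\<close>. The first term is at most the old
  energy since \<open>A'\<close> dominates \<open>A\<close>, and the last factor is controlled by
  the growth of the determinant.\<close>

lemma ridge_energy_Suc:
  "ridge_energy p e (Suc t) \<le> ridge_energy p e t + 2 * (e (Suc t) * ridge_cross p e t)
     + (e (Suc t))\<^sup>2 * (ln (ridge_det p (Suc t)) - ln (ridge_det p t))"
proof -
  define a b c u v d d' x w where defs: "a = 1 + real t" "b = (\<Sum>\<tau>=1..t. p \<tau>)" "c = 1 + (\<Sum>\<tau>=1..t. (p \<tau>)\<^sup>2)"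
    "u = (\<Sum>\<tau>=1..t. e \<tau>)" "v = (\<Sum>\<tau>=1..t. p \<tau> * e \<tau>)" "d = ridge_det p t" "d' = ridge_det p (Suc t)"
    "x = p (Suc t)" "w = e (Suc t)"
  have d: "d = a * c - b\<^sup>2" "d \<ge> 1" "d' \<ge> 1"
    using ridge_det_ge_1[of p t] ridge_det_ge_1[of p "Suc t"] by (auto simp: defs ridge_det_def)
  have d': "d' = d + (c - 2 * b * x + a * x\<^sup>2)"
    using ridge_det_Suc[of p t] by (simp add: defs)
  have Q: "ridge_energy p e t = (c * u\<^sup>2 - 2 * b * u * v + a * v\<^sup>2) / d"
    by (simp add: defs ridge_energy_def)
  have Q': "ridge_energy p e (Suc t)
     = ((c + x\<^sup>2) * (u + w)\<^sup>2 - 2 * (b + x) * (u + w) * (v + x * w) + (a + 1) * (v + x * w)\<^sup>2) / d'"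
    by (simp add: defs ridge_energy_def algebra_simps)
  have G: "ridge_cross p e t = ((c + x\<^sup>2 - x * (b + x)) * u + ((a + 1) * x - (b + x)) * v) / d'"
    by (simp add: defs ridge_cross_def algebra_simps)
  \<comment> \<open>Sherman-Morrison with denominators cleared: the loss of energy from enlarging
    \<open>A\<close> is a perfect square, that of \<open>x^T adj(A) S\<close>, over
    \<open>d * d'\<close>.\<close>
  have sq: "d' * (c * u\<^sup>2 - 2 * b * u * v + a * v\<^sup>2)
       - d * ((c + x\<^sup>2) * u\<^sup>2 - 2 * (b + x) * u * v + (a + 1) * v\<^sup>2)
     = ((c - x * b) * u + (a * x - b) * v)\<^sup>2"
    unfolding d'  d(1) by algebra
  have "((c + x\<^sup>2) * u\<^sup>2 - 2 * (b + x) * u * v + (a + 1) * v\<^sup>2) / d'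
       \<le> (c * u\<^sup>2 - 2 * b * u * v + a * v\<^sup>2) / d"
    using d sq zero_le_power2[of "(c - x * b) * u + (a * x - b) * v"] by (simp add: field_simps)
  moreover have "ridge_energy p e (Suc t) =
      ((c + x\<^sup>2) * u\<^sup>2 - 2 * (b + x) * u * v + (a + 1) * v\<^sup>2) / d' + 2 * (w * ridge_cross p e t)
      + w\<^sup>2 * ((d' - d) / d')"
  proof -
    have "(c + x\<^sup>2) * (u + w)\<^sup>2 - 2 * (b + x) * (u + w) * (v + x * w) + (a + 1) * (v + x * w)\<^sup>2
      = ((c + x\<^sup>2) * u\<^sup>2 - 2 * (b + x) * u * v + (a + 1) * v\<^sup>2)
        + 2 * (w * ((c + x\<^sup>2 - x * (b + x)) * u + ((a + 1) * x - (b + x)) * v)) + w\<^sup>2 * (d' - d)"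
      unfolding d' by algebra
    moreover have "(A + 2 * (w * B) + w\<^sup>2 * E) / d' = A / d' + 2 * (w * (B / d')) + w\<^sup>2 * (E / d')" for A B E
      by (simp add: add_divide_distrib)
    ultimately show ?thesis unfolding Q' G by (simp only:)
  qed
  \<comment> \<open>The left side is \<open>x^T A'^-1 x\<close>; the bound is
    \<open>ln z <= z - 1\<close> at \<open>z = d / d'\<close>. It is what makes the sum over days
    telescope.\<close>
  moreover have "(d' - d) / d' \<le> ln d' - ln d"
  proof -
    have "ln (d / d') \<le> d / d' - 1" using d(2,3) by (intro ln_le_minus_one) auto
    then show ?thesis using d(2,3) by (simp add: ln_div diff_divide_distrib)
  qed
  then have "w\<^sup>2 * ((d' - d) / d') \<le> w\<^sup>2 * (ln d' - ln d)"
    by (intro mult_left_mono) auto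
  ultimately show ?thesis unfolding Q by (simp add: defs)
qed

lemma ridge_det_le:
  assumes "\<And>\<tau>. 1 \<le> \<tau> \<Longrightarrow> \<tau> \<le> t \<Longrightarrow> \<bar>p \<tau>\<bar> \<le> K"
  shows "ridge_det p t \<le> (1 + real t) * (1 + real t * K\<^sup>2)"
proof -
  have "(\<Sum>\<tau>=1..t. (p \<tau>)\<^sup>2) \<le> (\<Sum>\<tau>=1..t. K\<^sup>2)"
    using assms by (intro sum_mono) (metis atLeastAtMost_iff power2_abs power_mono abs_ge_zero)
  then have "(1 + real t) * (1 + (\<Sum>\<tau>=1..t. (p \<tau>)\<^sup>2)) \<le> (1 + real t) * (1 + real t * K\<^sup>2)"
    by (intro mult_left_mono) auto
  then show ?thesis unfolding ridge_det_def by (smt (verit) zero_le_power2)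
qed

section \<open>Least squares: normal equations and uniqueness of the minimiser\<close>

text \<open>The hypotheses are the normal equations, so all cross terms vanish and Pythagoras
  remains.\<close>

lemma lsq_err_expand:
  assumes "(\<Sum>\<tau>=1..t. \<Psi> \<tau> - (a - b * p \<tau>)) = 0" "(\<Sum>\<tau>=1..t. (\<Psi> \<tau> - (a - b * p \<tau>)) * p \<tau>) = 0"
  shows "lsq_err p \<Psi> t (x, y) = lsq_err p \<Psi> t (a, b) + (\<Sum>\<tau>=1..t. ((x - a) - (y - b) * p \<tau>)\<^sup>2)"
proof -
  define r where "r \<tau> = \<Psi> \<tau> - (a - b * p \<tau>)" for \<tau>
  have "lsq_err p \<Psi> t (x, y) = (\<Sum>\<tau>=1..t. (r \<tau>)\<^sup>2 + ((x - a) - (y - b) * p \<tau>)\<^sup>2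
       - 2 * (x - a) * r \<tau> + 2 * (y - b) * (r \<tau> * p \<tau>))"
    unfolding lsq_err_def r_def by (intro sum.cong) (auto simp: power2_eq_square algebra_simps)
  also have "\<dots> = (\<Sum>\<tau>=1..t. (r \<tau>)\<^sup>2) + (\<Sum>\<tau>=1..t. ((x - a) - (y - b) * p \<tau>)\<^sup>2)
       - 2 * (x - a) * (\<Sum>\<tau>=1..t. r \<tau>) + 2 * (y - b) * (\<Sum>\<tau>=1..t. r \<tau> * p \<tau>)"
    by (simp only: sum.distrib sum_subtractf sum_distrib_left)
  finally show ?thesis using assms by (simp add: lsq_err_def r_def)
qed

text \<open>Cramer's rule for the normal equations. The sign is opposite to the usual regression
  slope because demand is modelled as \<open>a - b * p\<close>.\<close>

definition ls_slope :: "(nat \<Rightarrow> real) \<Rightarrow> (nat \<Rightarrow> real) \<Rightarrow> nat \<Rightarrow> real" where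
  "ls_slope p \<Psi> t =
     ((\<Sum>\<tau>=1..t. p \<tau>) * (\<Sum>\<tau>=1..t. \<Psi> \<tau>) - real t * (\<Sum>\<tau>=1..t. \<Psi> \<tau> * p \<tau>))
     / (real t * (\<Sum>\<tau>=1..t. (p \<tau>)\<^sup>2) - (\<Sum>\<tau>=1..t. p \<tau>)\<^sup>2)"

definition ls_intercept :: "(nat \<Rightarrow> real) \<Rightarrow> (nat \<Rightarrow> real) \<Rightarrow> nat \<Rightarrow> real" where
  "ls_intercept p \<Psi> t = ((\<Sum>\<tau>=1..t. \<Psi> \<tau>) + ls_slope p \<Psi> t * (\<Sum>\<tau>=1..t. p \<tau>)) / real t"

text \<open>A nonzero affine function cannot vanish at two distinct prices; days 1 and 2 already
  make the design positive definite.\<close>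

lemma sum_residuals_pos:
  fixes p :: "nat \<Rightarrow> real"
  assumes "2 \<le> t" "p 1 \<noteq> p 2" "(x, y) \<noteq> (0, 0)"
  shows "0 < (\<Sum>\<tau>=1..t. (x - y * p \<tau>)\<^sup>2)"
proof (rule ccontr)
  assume "\<not> ?thesis"
  then have "(\<Sum>\<tau>=1..t. (x - y * p \<tau>)\<^sup>2) = 0"
    by (meson linorder_not_less order_antisym sum_nonneg zero_le_power2)
  then have "\<forall>\<tau>\<in>{1..t}. (x - y * p \<tau>)\<^sup>2 = 0"
    by (subst (asm) sum_nonneg_eq_0_iff) auto
  then have "x = y * p 1" "x = y * p 2" using assms(1) by auto
  then show False using assms(2,3) by auto
qed

text \<open>\<open>ls_raw\<close> is a Hilbert choice, so uniqueness is needed to identify it. The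
  closed form serves measurability, the minimality serves the error bound.\<close>

lemma ls_raw_eq:
  assumes t: "2 \<le> t" and p: "p 1 \<noteq> p 2"
  shows "ls_raw p \<Psi> t = (ls_intercept p \<Psi> t, ls_slope p \<Psi> t)" (is "_ = (?a, ?b)")
    and "lsq_err p \<Psi> t (ls_raw p \<Psi> t) \<le> lsq_err p \<Psi> t ab"
proof -
  define s q n where defs: "s = (\<Sum>\<tau>=1..t. p \<tau>)" "q = (\<Sum>\<tau>=1..t. (p \<tau>)\<^sup>2)" "n = real t"
  define f g where fg: "f = (\<Sum>\<tau>=1..t. \<Psi> \<tau>)" "g = (\<Sum>\<tau>=1..t. \<Psi> \<tau> * p \<tau>)"
  have n: "n > 0" using t by (simp add: defs)
  \<comment> \<open>Residuals about the mean price \<open>s / n\<close>: their sum of squares is the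
    determinant of the normal equations divided by \<open>n\<close>.\<close>
  have "0 < (\<Sum>\<tau>=1..t. (s / n - 1 * p \<tau>)\<^sup>2)"
    using t p by (intro sum_residuals_pos) auto
  also have "(\<Sum>\<tau>=1..t. (s / n - 1 * p \<tau>)\<^sup>2) = (\<Sum>\<tau>=1..t. (s / n)\<^sup>2 - 2 * (s / n) * p \<tau> + (p \<tau>)\<^sup>2)"
    by (simp add: power2_diff algebra_simps)
  also have "\<dots> = n * (s / n)\<^sup>2 - 2 * (s / n) * s + q"
    unfolding defs by (simp only: sum.distrib sum_subtractf sum_distrib_left) simp
  also have "\<dots> = (n * q - s\<^sup>2) / n" using n by (simp add: field_simps power2_eq_square)
  finally have D: "n * q - s\<^sup>2 > 0" using n by (simp add: zero_less_divide_iff)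
  have b: "?b * (n * q - s\<^sup>2) = s * f - n * g"
    using D unfolding ls_slope_def defs fg by simp
  have a: "?a * n = f + ?b * s" using n unfolding ls_intercept_def defs fg by simp
  have 1: "(\<Sum>\<tau>=1..t. \<Psi> \<tau> - (?a - ?b * p \<tau>)) = 0"
  proof -
    have "(\<Sum>\<tau>=1..t. \<Psi> \<tau> - (?a - ?b * p \<tau>)) = f - (?a * n - ?b * s)"
      unfolding defs fg by (simp add: sum_subtractf sum_distrib_left)
    then show ?thesis using a by simp
  qed
  have 2: "(\<Sum>\<tau>=1..t. (\<Psi> \<tau> - (?a - ?b * p \<tau>)) * p \<tau>) = 0"
  proof -
    have "(\<Sum>\<tau>=1..t. (\<Psi> \<tau> - (?a - ?b * p \<tau>)) * p \<tau>) = g - ?a * s + ?b * q"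
      unfolding defs fg
      by (simp add: sum_subtractf sum.distrib sum_distrib_left power2_eq_square algebra_simps)
    moreover have "n * (g - ?a * s + ?b * q) = 0" using a b by algebra
    ultimately show ?thesis using n by simp
  qed
  note expand = lsq_err_expand[OF 1 2]
  have min: "\<forall>ab'. lsq_err p \<Psi> t (?a, ?b) \<le> lsq_err p \<Psi> t ab'"
  proof
    fix ab'
    have "0 \<le> (\<Sum>\<tau>=1..t. ((fst ab' - ?a) - (snd ab' - ?b) * p \<tau>)\<^sup>2)" by (intro sum_nonneg) auto
    then show "lsq_err p \<Psi> t (?a, ?b) \<le> lsq_err p \<Psi> t ab'" using expand[of "fst ab'" "snd ab'"] by simp
  qed
  show eq: "ls_raw p \<Psi> t = (?a, ?b)"
    unfolding ls_raw_def
  proof (rule some_equality)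
    show "\<forall>ab'. lsq_err p \<Psi> t (?a, ?b) \<le> lsq_err p \<Psi> t ab'" by (rule min)
    fix ab' assume *: "\<forall>ab''. lsq_err p \<Psi> t ab' \<le> lsq_err p \<Psi> t ab''"
    have "lsq_err p \<Psi> t ab' \<le> lsq_err p \<Psi> t (?a, ?b)" using * by blast
    then have "\<not> 0 < (\<Sum>\<tau>=1..t. ((fst ab' - ?a) - (snd ab' - ?b) * p \<tau>)\<^sup>2)"
      using expand[of "fst ab'" "snd ab'"] by simp
    then have "(fst ab' - ?a, snd ab' - ?b) = (0, 0)"
      using sum_residuals_pos[OF t p] by blast
    then show "ab' = (?a, ?b)" by (simp add: prod_eq_iff)
  qed
  show "lsq_err p \<Psi> t (ls_raw p \<Psi> t) \<le> lsq_err p \<Psi> t ab"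
    unfolding eq using min by blast
qed

section \<open>Expected energy under predictable regressors\<close>

text \<open>Energies and coefficients are built from finitely many bounded prices and shocks, so
  closure rules give integrability and, over a smaller sigma-algebra \<open>F\<close>,
  predictability at once.\<close>

definition bounded_rv :: "'a measure \<Rightarrow> ('a \<Rightarrow> real) \<Rightarrow> bool" where
  "bounded_rv F f \<longleftrightarrow> f \<in> borel_measurable F \<and> (\<exists>B. \<forall>\<omega>\<in>space F. \<bar>f \<omega>\<bar> \<le> B)"

lemma bounded_rvI:
  assumes "f \<in> borel_measurable F" "\<And>\<omega>. \<omega> \<in> space F \<Longrightarrow> \<bar>f \<omega>\<bar> \<le> B"
  shows "bounded_rv F f"
  using assms unfolding bounded_rv_def by blast

lemma bounded_rv_const: "bounded_rv F (\<lambda>_. k)"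
  by (rule bounded_rvI[where B = "\<bar>k\<bar>"]) auto

lemma bounded_rv_add:
  assumes "bounded_rv F f" "bounded_rv F g"
  shows "bounded_rv F (\<lambda>\<omega>. f \<omega> + g \<omega>)"
proof -
  obtain B C where "\<forall>\<omega>\<in>space F. \<bar>f \<omega>\<bar> \<le> B" "\<forall>\<omega>\<in>space F. \<bar>g \<omega>\<bar> \<le> C"
    using assms unfolding bounded_rv_def by blast
  then show ?thesis
    using assms by (intro bounded_rvI[where B = "B + C"]) (fastforce simp: bounded_rv_def)+
qed

lemma bounded_rv_mult:
  assumes "bounded_rv F f" "bounded_rv F g"
  shows "bounded_rv F (\<lambda>\<omega>. f \<omega> * g \<omega>)"
proof -
  obtain B C where BC: "\<forall>\<omega>\<in>space F. \<bar>f \<omega>\<bar> \<le> B" "\<forall>\<omega>\<in>space F. \<bar>g \<omega>\<bar> \<le> C"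
    using assms unfolding bounded_rv_def by blast
  have "\<bar>f \<omega> * g \<omega>\<bar> \<le> B * C" if "\<omega> \<in> space F" for \<omega>
    unfolding abs_mult using BC that by (intro mult_mono) (auto intro: order_trans[OF abs_ge_zero])
  then show ?thesis
    using assms by (intro bounded_rvI[where B = "B * C"]) (auto simp: bounded_rv_def)
qed

lemma bounded_rv_diff:
  assumes "bounded_rv F f" "bounded_rv F g"
  shows "bounded_rv F (\<lambda>\<omega>. f \<omega> - g \<omega>)"
  using bounded_rv_add[OF assms(1) bounded_rv_mult[OF bounded_rv_const[of F "-1"] assms(2)]] by simp

lemma bounded_rv_power2: "bounded_rv F f \<Longrightarrow> bounded_rv F (\<lambda>\<omega>. (f \<omega>)\<^sup>2)"
  unfolding power2_eq_square by (rule bounded_rv_mult)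

lemma bounded_rv_sum:
  assumes "\<And>i. i \<in> I \<Longrightarrow> bounded_rv F (f i)"
  shows "bounded_rv F (\<lambda>\<omega>. \<Sum>i\<in>I. f i \<omega>)"
  using assms by (induction I rule: infinite_finite_induct) (auto intro: bounded_rv_const bounded_rv_add)

lemma bounded_rv_divide:
  assumes "bounded_rv F f" "bounded_rv F g" "\<And>\<omega>. 1 \<le> g \<omega>"
  shows "bounded_rv F (\<lambda>\<omega>. f \<omega> / g \<omega>)"
proof -
  have "bounded_rv F (\<lambda>\<omega>. 1 / g \<omega>)"
  proof (rule bounded_rvI[where B = 1])
    show "(\<lambda>\<omega>. 1 / g \<omega>) \<in> borel_measurable F" using assms(2) by (auto simp: bounded_rv_def)
    show "\<bar>1 / g \<omega>\<bar> \<le> 1" for \<omega> using assms(3)[of \<omega>] by (simp add: divide_le_eq)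
  qed
  from bounded_rv_mult[OF assms(1) this] show ?thesis by simp
qed

lemma bounded_rv_ln:
  assumes "bounded_rv F g" "\<And>\<omega>. 1 \<le> g \<omega>"
  shows "bounded_rv F (\<lambda>\<omega>. ln (g \<omega>))"
proof -
  obtain C where C: "\<forall>\<omega>\<in>space F. \<bar>g \<omega>\<bar> \<le> C"
    using assms unfolding bounded_rv_def by blast
  show ?thesis
  proof (rule bounded_rvI[where B = C])
    show "(\<lambda>\<omega>. ln (g \<omega>)) \<in> borel_measurable F" using assms(1) by (auto simp: bounded_rv_def)
    fix \<omega> assume "\<omega> \<in> space F"
    moreover have "0 \<le> ln (g \<omega>)" "ln (g \<omega>) \<le> g \<omega> - 1"
      using assms(2)[of \<omega>] by (auto intro: ln_le_minus_one)
    ultimately show "\<bar>ln (g \<omega>)\<bar> \<le> C" using C assms(2)[of \<omega>] by fastforce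
  qed
qed

lemmas bounded_rv_intros = bounded_rv_const bounded_rv_add bounded_rv_diff bounded_rv_mult
  bounded_rv_power2 bounded_rv_sum bounded_rv_divide bounded_rv_ln

lemma bounded_rv_subalgebra:
  assumes "subalgebra M F" "bounded_rv F f"
  shows "bounded_rv M f"
  using assms measurable_from_subalg[OF assms(1)] unfolding bounded_rv_def subalgebra_def by metis

lemma bounded_rv_mono:
  assumes "space F = space G" "sets F \<subseteq> sets G" "bounded_rv F f"
  shows "bounded_rv G f"
  using bounded_rv_subalgebra[of G F f] assms by (simp add: subalgebra_def)

lemma (in prob_space) bounded_rv_integrable: "bounded_rv M f \<Longrightarrow> integrable M f"
  unfolding bounded_rv_def by (auto intro!: integrable_const_bound[where f = f] AE_I2)

lemma bounded_rv_ridge_det: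
  assumes "\<And>\<tau>. 1 \<le> \<tau> \<Longrightarrow> \<tau> \<le> t \<Longrightarrow> bounded_rv F (p \<tau>)"
  shows "bounded_rv F (\<lambda>\<omega>. ridge_det (\<lambda>\<tau>. p \<tau> \<omega>) t)"
  unfolding ridge_det_def using assms by (intro bounded_rv_intros) auto

lemma bounded_rv_ridge_energy:
  assumes "\<And>\<tau>. 1 \<le> \<tau> \<Longrightarrow> \<tau> \<le> t \<Longrightarrow> bounded_rv F (p \<tau>)" "\<And>\<tau>. 1 \<le> \<tau> \<Longrightarrow> \<tau> \<le> t \<Longrightarrow> bounded_rv F (e \<tau>)"
  shows "bounded_rv F (\<lambda>\<omega>. ridge_energy (\<lambda>\<tau>. p \<tau> \<omega>) (\<lambda>\<tau>. e \<tau> \<omega>) t)"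
  unfolding ridge_energy_def using assms
  by (intro bounded_rv_intros bounded_rv_ridge_det ridge_det_ge_1) auto

lemma bounded_rv_ridge_cross:
  assumes "\<And>\<tau>. 1 \<le> \<tau> \<Longrightarrow> \<tau> \<le> Suc t \<Longrightarrow> bounded_rv F (p \<tau>)" "\<And>\<tau>. 1 \<le> \<tau> \<Longrightarrow> \<tau> \<le> t \<Longrightarrow> bounded_rv F (e \<tau>)"
  shows "bounded_rv F (\<lambda>\<omega>. ridge_cross (\<lambda>\<tau>. p \<tau> \<omega>) (\<lambda>\<tau>. e \<tau> \<omega>) t)"
  unfolding ridge_cross_def using assms
  by (intro bounded_rv_intros bounded_rv_ridge_det ridge_det_ge_1) auto

text \<open>\<open>F t\<close> is the information before day \<open>t\<close>: the price of day
  \<open>t\<close> is known, its shock only at \<open>Suc t\<close>. The martingale difference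
  property appears as orthogonality to bounded \<open>F t\<close>-variables, which avoids
  conditional expectations.\<close>

lemma (in prob_space) expectation_ridge_energy_le_log_det:
  fixes F :: "nat \<Rightarrow> 'a measure" and p e :: "nat \<Rightarrow> 'a \<Rightarrow> real"
  assumes sub: "\<And>t. subalgebra M (F t)"
    and mono: "\<And>s t. s \<le> t \<Longrightarrow> sets (F s) \<subseteq> sets (F t)"
    and p: "\<And>t. 1 \<le> t \<Longrightarrow> bounded_rv (F t) (p t)"
    and e: "\<And>t. 1 \<le> t \<Longrightarrow> bounded_rv (F (Suc t)) (e t)"
    and eB: "\<And>t \<omega>. 1 \<le> t \<Longrightarrow> \<omega> \<in> space M \<Longrightarrow> \<bar>e t \<omega>\<bar> \<le> B"
    and orth: "\<And>t G. 1 \<le> t \<Longrightarrow> bounded_rv (F t) G \<Longrightarrow> expectation (\<lambda>\<omega>. e t \<omega> * G \<omega>) = 0"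
  shows "expectation (\<lambda>\<omega>. ridge_energy (\<lambda>\<tau>. p \<tau> \<omega>) (\<lambda>\<tau>. e \<tau> \<omega>) t)
           \<le> B\<^sup>2 * expectation (\<lambda>\<omega>. ln (ridge_det (\<lambda>\<tau>. p \<tau> \<omega>) t))"
proof (induction t)
  case 0
  then show ?case by (simp add: ridge_det_def)
next
  case (Suc t)
  have sp: "space (F t) = space M" for t using sub[of t] by (simp add: subalgebra_def)
  have pM: "bounded_rv M (p t)" if "1 \<le> t" for t
    using bounded_rv_subalgebra[OF sub p[OF that]] .
  have eM: "bounded_rv M (e t)" if "1 \<le> t" for t
    using bounded_rv_subalgebra[OF sub e[OF that]] .
  let ?Q = "\<lambda>t \<omega>. ridge_energy (\<lambda>\<tau>. p \<tau> \<omega>) (\<lambda>\<tau>. e \<tau> \<omega>) t"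
  let ?L = "\<lambda>t \<omega>. ln (ridge_det (\<lambda>\<tau>. p \<tau> \<omega>) t)"
  let ?G = "\<lambda>\<omega>. ridge_cross (\<lambda>\<tau>. p \<tau> \<omega>) (\<lambda>\<tau>. e \<tau> \<omega>) t"
  have Q: "integrable M (?Q t)" for t
    by (intro bounded_rv_integrable bounded_rv_ridge_energy pM eM) auto
  have L: "integrable M (?L t)" for t
    by (intro bounded_rv_integrable bounded_rv_ln bounded_rv_ridge_det pM ridge_det_ge_1) auto
  \<comment> \<open>The coefficient involves prices up to \<open>Suc t\<close> but shocks only up to
    \<open>t\<close>, hence it is known just before shock \<open>Suc t\<close>.\<close>
  have G: "bounded_rv (F (Suc t)) ?G"
  proof (rule bounded_rv_ridge_cross)
    fix \<tau> :: nat assume "1 \<le> \<tau>" "\<tau> \<le> Suc t"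
    then show "bounded_rv (F (Suc t)) (p \<tau>)" using mono[of \<tau> "Suc t"] p sp by (auto intro: bounded_rv_mono[of "F \<tau>"])
  next
    fix \<tau> :: nat assume "1 \<le> \<tau>" "\<tau> \<le> t"
    then show "bounded_rv (F (Suc t)) (e \<tau>)" using mono[of "Suc \<tau>" "Suc t"] e sp by (auto intro: bounded_rv_mono[of "F (Suc \<tau>)"])
  qed
  have eG: "integrable M (\<lambda>\<omega>. e (Suc t) \<omega> * ?G \<omega>)"
    by (intro bounded_rv_integrable bounded_rv_mult eM bounded_rv_subalgebra[OF sub G]) auto
  have "expectation (?Q (Suc t))
      \<le> expectation (\<lambda>\<omega>. ?Q t \<omega> + 2 * (e (Suc t) \<omega> * ?G \<omega>) + B\<^sup>2 * (?L (Suc t) \<omega> - ?L t \<omega>))"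
  proof (rule integral_mono)
    fix \<omega> assume \<omega>: "\<omega> \<in> space M"
    have "(e (Suc t) \<omega>)\<^sup>2 \<le> B\<^sup>2"
      using eB[of "Suc t" \<omega>] \<omega> by (metis abs_ge_zero le_add1 plus_1_eq_Suc power2_abs power_mono)
    moreover have "0 \<le> ?L (Suc t) \<omega> - ?L t \<omega>"
      using ridge_det_mono[of "\<lambda>\<tau>. p \<tau> \<omega>" t] ridge_det_ge_1[of "\<lambda>\<tau>. p \<tau> \<omega>" t]
      by (smt (verit) ln_le_cancel_iff)
    ultimately have "(e (Suc t) \<omega>)\<^sup>2 * (?L (Suc t) \<omega> - ?L t \<omega>) \<le> B\<^sup>2 * (?L (Suc t) \<omega> - ?L t \<omega>)"
      by (rule mult_right_mono)
    then show "?Q (Suc t) \<omega> \<le> ?Q t \<omega> + 2 * (e (Suc t) \<omega> * ?G \<omega>) + B\<^sup>2 * (?L (Suc t) \<omega> - ?L t \<omega>)"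
      using ridge_energy_Suc[of "\<lambda>\<tau>. p \<tau> \<omega>" "\<lambda>\<tau>. e \<tau> \<omega>" t] by linarith
  qed (use Q L eG in auto)
  also have "\<dots> = expectation (?Q t) + 2 * expectation (\<lambda>\<omega>. e (Suc t) \<omega> * ?G \<omega>)
       + B\<^sup>2 * (expectation (?L (Suc t)) - expectation (?L t))"
    using Q[of t] L[of t] L[of "Suc t"] eG by simp
  also have "\<dots> \<le> B\<^sup>2 * expectation (?L (Suc t))"
    using Suc.IH orth[OF _ G] by (simp add: algebra_simps)
  finally show ?case .
qed

lemma (in prob_space) expectation_ridge_energy_le:
  fixes F :: "nat \<Rightarrow> 'a measure" and p e :: "nat \<Rightarrow> 'a \<Rightarrow> real"
  assumes sub: "\<And>t. subalgebra M (F t)"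
    and mono: "\<And>s t. s \<le> t \<Longrightarrow> sets (F s) \<subseteq> sets (F t)"
    and p: "\<And>t. 1 \<le> t \<Longrightarrow> p t \<in> borel_measurable (F t)"
    and pK: "\<And>t \<omega>. 1 \<le> t \<Longrightarrow> \<omega> \<in> space M \<Longrightarrow> \<bar>p t \<omega>\<bar> \<le> K"
    and e: "\<And>t. 1 \<le> t \<Longrightarrow> e t \<in> borel_measurable (F (Suc t))"
    and eB: "\<And>t \<omega>. 1 \<le> t \<Longrightarrow> \<omega> \<in> space M \<Longrightarrow> \<bar>e t \<omega>\<bar> \<le> B"
    and orth: "\<And>t G. 1 \<le> t \<Longrightarrow> bounded_rv (F t) G \<Longrightarrow> expectation (\<lambda>\<omega>. e t \<omega> * G \<omega>) = 0"
    and t: "2 \<le> t"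
  shows "integrable M (\<lambda>\<omega>. ridge_energy (\<lambda>\<tau>. p \<tau> \<omega>) (\<lambda>\<tau>. e \<tau> \<omega>) t)" (is "integrable M ?Q")
    and "expectation (\<lambda>\<omega>. ridge_energy (\<lambda>\<tau>. p \<tau> \<omega>) (\<lambda>\<tau>. e \<tau> \<omega>) t)
           \<le> B\<^sup>2 * (3 + ln (1 + K\<^sup>2) / ln 2) * ln (real t)"
proof -
  have sp: "space (F t) = space M" for t using sub[of t] by (simp add: subalgebra_def)
  have pb: "bounded_rv (F t) (p t)" if "1 \<le> t" for t
    using p pK that sp by (intro bounded_rvI[where B = K]) auto
  have eb: "bounded_rv (F (Suc t)) (e t)" if "1 \<le> t" for t
    using e eB that sp by (intro bounded_rvI[where B = B]) auto
  have pM: "bounded_rv M (p t)" if "1 \<le> t" for t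
    using bounded_rv_subalgebra[OF sub pb[OF that]] .
  have eM: "bounded_rv M (e t)" if "1 \<le> t" for t
    using bounded_rv_subalgebra[OF sub eb[OF that]] .
  show "integrable M ?Q"
    by (intro bounded_rv_integrable bounded_rv_ridge_energy pM eM) auto
  let ?L = "\<lambda>\<omega>. ln (ridge_det (\<lambda>\<tau>. p \<tau> \<omega>) t)"
  have L: "integrable M ?L"
    by (intro bounded_rv_integrable bounded_rv_ln bounded_rv_ridge_det pM ridge_det_ge_1) auto
  have "expectation ?L \<le> expectation (\<lambda>_. 3 * ln (real t) + ln (1 + K\<^sup>2))"
  proof (rule integral_mono[OF L])
    fix \<omega> assume \<omega>: "\<omega> \<in> space M"
    have "ridge_det (\<lambda>\<tau>. p \<tau> \<omega>) t \<le> (1 + real t) * (1 + real t * K\<^sup>2)"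
      using pK \<omega> by (intro ridge_det_le) auto
    \<comment> \<open>Any polynomial bound on the determinant would do; the cubic one yields the
      constant 3 in front of the logarithm.\<close>
    also have "\<dots> \<le> (real t * real t) * (real t * (1 + K\<^sup>2))"
    proof (rule mult_mono)
      have "2 * real t \<le> real t * real t" using t by (intro mult_right_mono) auto
      then show "1 + real t \<le> real t * real t" using t by linarith
    qed (use t in \<open>auto simp: algebra_simps\<close>)
    finally have "?L \<omega> \<le> ln ((real t * real t) * (real t * (1 + K\<^sup>2)))"
      using ridge_det_ge_1[of "\<lambda>\<tau>. p \<tau> \<omega>" t] by (intro ln_mono) auto
    also have "\<dots> = 3 * ln (real t) + ln (1 + K\<^sup>2)"
    proof -
      have "1 + K\<^sup>2 > 0" by (intro add_pos_nonneg) auto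
      then show ?thesis using t by (simp add: ln_mult_pos)
    qed
    finally show "?L \<omega> \<le> 3 * ln (real t) + ln (1 + K\<^sup>2)" .
  qed simp
  also have "\<dots> = 3 * ln (real t) + ln (1 + K\<^sup>2)" by (simp add: prob_space)
  \<comment> \<open>As \<open>t\<close> is at least 2, \<open>ln (real t) / ln 2\<close> is at least
    1 and absorbs the additive constant into the logarithm.\<close>
  also have "\<dots> \<le> 3 * ln (real t) + ln (1 + K\<^sup>2) * (ln (real t) / ln 2)"
  proof -
    have "1 \<le> ln (real t) / ln 2" using t by simp
    then have "ln (1 + K\<^sup>2) * 1 \<le> ln (1 + K\<^sup>2) * (ln (real t) / ln 2)"
      by (rule mult_left_mono) simp
    then show ?thesis by simp
  qed
  also have "\<dots> = (3 + ln (1 + K\<^sup>2) / ln 2) * ln (real t)" by (simp only: distrib_right times_divide_eq_left times_divide_eq_right)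
  finally have "B\<^sup>2 * expectation ?L \<le> B\<^sup>2 * ((3 + ln (1 + K\<^sup>2) / ln 2) * ln (real t))"
    by (intro mult_left_mono) auto
  moreover have "expectation ?Q \<le> B\<^sup>2 * expectation ?L"
    by (rule expectation_ridge_energy_le_log_det[where F = F]) (fact sub mono pb eb eB orth)+
  ultimately show "expectation ?Q \<le> B\<^sup>2 * (3 + ln (1 + K\<^sup>2) / ln 2) * ln (real t)"
    unfolding mult.assoc by (rule order_trans[rotated])
qed

section \<open>Estimation error and energy\<close>

lemma clip_contract:
  assumes "lo \<le> y" "y \<le> hi"
  shows "\<bar>clip lo hi x - y\<bar> \<le> \<bar>x - y\<bar>"
  using assms by (auto simp: clip_def)

lemma clip_in_interval: "lo \<le> hi \<Longrightarrow> clip lo hi x \<in> {lo..hi}"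
  by (auto simp: clip_def)

text \<open>For odd \<open>t\<close> the last day has no partner and its nonnegative term is
  dropped.\<close>

lemma sum_pairs_le:
  fixes f :: "nat \<Rightarrow> real"
  assumes "\<And>\<tau>. 0 \<le> f \<tau>"
  shows "(\<Sum>k=1..t div 2. f (2 * k - 1) + f (2 * k)) \<le> (\<Sum>\<tau>=1..t. f \<tau>)"
proof -
  have "(\<Sum>k=1..n. f (2 * k - 1) + f (2 * k)) = (\<Sum>\<tau>=1..2 * n. f \<tau>)" for n
    by (induction n) auto
  also have "(\<Sum>\<tau>=1..2 * (t div 2). f \<tau>) \<le> (\<Sum>\<tau>=1..t. f \<tau>)"
    using assms by (intro sum_mono2) auto
  finally show ?thesis .
qed

text \<open>Each pair of days contributes half the squared price gap times \<open>y\<close> squared,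
  whatever the intercept \<open>x\<close> is. There are \<open>t div 2\<close> pairs, at least a
  third of \<open>t\<close>, which gives the 6; every gap is at least the one prescribed at time
  \<open>t\<close>.\<close>

lemma sum_residuals_ge:
  fixes p :: "nat \<Rightarrow> real"
  assumes t: "2 \<le> t" and g: "0 < g" and \<eta>: "0 < \<eta>"
    and gap: "\<And>k. 1 \<le> k \<Longrightarrow> 2 * k \<le> t \<Longrightarrow> g * real (2 * k) powr (- \<eta>) \<le> \<bar>p (2 * k - 1) - p (2 * k)\<bar>"
  shows "g\<^sup>2 / 6 * y\<^sup>2 * real t powr (1 - 2 * \<eta>) \<le> (\<Sum>\<tau>=1..t. (x - y * p \<tau>)\<^sup>2)"
proof -
  have pow: "real t powr (1 - 2 * \<eta>) = real t * (real t powr (- \<eta>))\<^sup>2"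
  proof -
    have "real t powr (1 - 2 * \<eta>) = real t powr (1 + (- \<eta> + - \<eta>))" by simp
    also have "\<dots> = real t * (real t powr (- \<eta>) * real t powr (- \<eta>))"
      using t by (simp only: powr_add) simp
    finally show ?thesis by (simp add: power2_eq_square)
  qed
  have rearrange: "G / 6 * Y * (T * R) = T / 3 * (Y * (G * R) / 2)" for G Y T R :: real
    by simp
  have diff: "y\<^sup>2 * (a - b)\<^sup>2 / 2 \<le> (x - y * a)\<^sup>2 + (x - y * b)\<^sup>2" for a b
  proof -
    have "0 \<le> ((x - y * a) + (x - y * b))\<^sup>2" by simp
    also have "\<dots> = 2 * ((x - y * a)\<^sup>2 + (x - y * b)\<^sup>2) - y\<^sup>2 * (a - b)\<^sup>2" by algebra
    finally show ?thesis by simp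
  qed
  have div: "real t / 3 \<le> real (t div 2)"
  proof -
    have "t \<le> 3 * (t div 2)" using t by presburger
    then have "real t \<le> real (3 * (t div 2))" by (rule of_nat_mono)
    then show ?thesis by simp
  qed
  have "g\<^sup>2 / 6 * y\<^sup>2 * real t powr (1 - 2 * \<eta>) = real t / 3 * (y\<^sup>2 * (g * real t powr (- \<eta>))\<^sup>2 / 2)"
    unfolding pow power_mult_distrib by (rule rearrange)
  also have "\<dots> \<le> real (t div 2) * (y\<^sup>2 * (g * real t powr (- \<eta>))\<^sup>2 / 2)"
    by (intro mult_right_mono div) auto
  also have "\<dots> = (\<Sum>k=1..t div 2. y\<^sup>2 * (g * real t powr (- \<eta>))\<^sup>2 / 2)" by simp
  also have "\<dots> \<le> (\<Sum>k=1..t div 2. (x - y * p (2 * k - 1))\<^sup>2 + (x - y * p (2 * k))\<^sup>2)"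
  proof (rule sum_mono)
    fix k assume k: "k \<in> {1..t div 2}"
    have "real t powr (- \<eta>) \<le> real (2 * k) powr (- \<eta>)"
      using k \<eta> by (intro powr_mono2') auto
    then have "g * real t powr (- \<eta>) \<le> g * real (2 * k) powr (- \<eta>)"
      using g by (intro mult_left_mono) auto
    also have "\<dots> \<le> \<bar>p (2 * k - 1) - p (2 * k)\<bar>" using gap[of k] k by auto
    finally have "g * real t powr (- \<eta>) \<le> \<bar>p (2 * k - 1) - p (2 * k)\<bar>" .
    then have "(g * real t powr (- \<eta>))\<^sup>2 \<le> \<bar>p (2 * k - 1) - p (2 * k)\<bar>\<^sup>2"
      using g by (intro power_mono) auto
    then have "(g * real t powr (- \<eta>))\<^sup>2 \<le> (p (2 * k - 1) - p (2 * k))\<^sup>2" by simp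
    then have "y\<^sup>2 * (g * real t powr (- \<eta>))\<^sup>2 / 2 \<le> y\<^sup>2 * (p (2 * k - 1) - p (2 * k))\<^sup>2 / 2"
      by (intro divide_right_mono mult_left_mono) auto
    also have "\<dots> \<le> (x - y * p (2 * k - 1))\<^sup>2 + (x - y * p (2 * k))\<^sup>2" by (rule diff)
    finally show "y\<^sup>2 * (g * real t powr (- \<eta>))\<^sup>2 / 2
        \<le> (x - y * p (2 * k - 1))\<^sup>2 + (x - y * p (2 * k))\<^sup>2" .
  qed
  also have "\<dots> \<le> (\<Sum>\<tau>=1..t. (x - y * p \<tau>)\<^sup>2)" by (rule sum_pairs_le) simp
  finally show ?thesis .
qed

text \<open>The slope is controlled by the gaps, and the intercept then follows by averaging over
  days, since \<open>x\<close> is a residual plus \<open>y * p \<tau>\<close> with bounded price.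
  The constant adds 2 for the residuals to \<open>2 * K^2 + 1\<close> times the slope bound.\<close>

lemma coefficients_le_sum_residuals:
  fixes p :: "nat \<Rightarrow> real"
  assumes t: "2 \<le> t" and g: "0 < g" and \<eta>: "0 < \<eta>" "\<eta> < 1 / 2"
    and K: "\<And>\<tau>. 1 \<le> \<tau> \<Longrightarrow> \<tau> \<le> t \<Longrightarrow> \<bar>p \<tau>\<bar> \<le> K"
    and gap: "\<And>k. 1 \<le> k \<Longrightarrow> 2 * k \<le> t \<Longrightarrow> g * real (2 * k) powr (- \<eta>) \<le> \<bar>p (2 * k - 1) - p (2 * k)\<bar>"
  shows "(x\<^sup>2 + y\<^sup>2) * real t powr (1 - 2 * \<eta>)
     \<le> (2 + (2 * K\<^sup>2 + 1) * 6 / g\<^sup>2) * (\<Sum>\<tau>=1..t. (x - y * p \<tau>)\<^sup>2)" (is "_ * ?r \<le> _ * ?S")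
proof -
  have "real t * x\<^sup>2 = (\<Sum>\<tau>=1..t. x\<^sup>2)" by simp
  also have "\<dots> \<le> (\<Sum>\<tau>=1..t. 2 * (x - y * p \<tau>)\<^sup>2 + 2 * K\<^sup>2 * y\<^sup>2)"
  proof (rule sum_mono)
    fix \<tau> assume "\<tau> \<in> {1..t}"
    then have "(p \<tau>)\<^sup>2 \<le> K\<^sup>2" using K[of \<tau>] by (metis abs_ge_zero atLeastAtMost_iff power2_abs power_mono)
    then have "(y * p \<tau>)\<^sup>2 \<le> K\<^sup>2 * y\<^sup>2" 
      unfolding power_mult_distrib mult.commute[of "y\<^sup>2"] by (rule mult_right_mono) simp
    moreover have "x\<^sup>2 \<le> 2 * (x - y * p \<tau>)\<^sup>2 + 2 * (y * p \<tau>)\<^sup>2"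
      using zero_le_power2[of "x - 2 * (y * p \<tau>)"] by (simp add: power2_eq_square algebra_simps)
    ultimately show "x\<^sup>2 \<le> 2 * (x - y * p \<tau>)\<^sup>2 + 2 * K\<^sup>2 * y\<^sup>2" by linarith
  qed
  also have "\<dots> = 2 * ?S + real t * (2 * K\<^sup>2 * y\<^sup>2)"
    by (simp add: sum.distrib sum_distrib_left)
  finally have x: "real t * (x\<^sup>2 - 2 * K\<^sup>2 * y\<^sup>2) \<le> 2 * ?S" by (simp add: algebra_simps)
  have r: "0 < ?r" "?r \<le> real t"
    using t \<eta> powr_mono[of "1 - 2 * \<eta>" 1 "real t"] by auto
  have S: "0 \<le> ?S" by (intro sum_nonneg) simp
  have "?r * (x\<^sup>2 - 2 * K\<^sup>2 * y\<^sup>2) \<le> 2 * ?S"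
  \<comment> \<open>Replacing \<open>t\<close> by the smaller power needs a nonnegative factor; a
    negative one makes the claim trivial.\<close>
  proof (cases "0 \<le> x\<^sup>2 - 2 * K\<^sup>2 * y\<^sup>2")
    case True
    then show ?thesis using x r mult_right_mono[OF r(2)] by (meson order_trans)
  next
    case False
    then have "?r * (x\<^sup>2 - 2 * K\<^sup>2 * y\<^sup>2) \<le> 0" using r by (simp add: mult_le_0_iff)
    then show ?thesis using S by linarith
  qed
  moreover have "y\<^sup>2 * ?r \<le> 6 / g\<^sup>2 * ?S"
    using sum_residuals_ge[OF t g \<eta>(1) gap, of y x] g by (simp add: field_simps)
  then have "(2 * K\<^sup>2 + 1) * (y\<^sup>2 * ?r) \<le> (2 * K\<^sup>2 + 1) * (6 / g\<^sup>2 * ?S)"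
    by (rule mult_left_mono) simp
  ultimately show ?thesis by (simp add: algebra_simps)
qed

text \<open>Comparing the minimiser with the truth gives the basic inequality: the squared
  prediction error is at most twice the pairing of the estimation error with \<open>S\<close>. The
  energy bounds that pairing, and the design bound converts prediction error into coefficient error.
  Clipping to a box containing the truth only helps.\<close>

lemma est_link_error_le:
  assumes t: "2 \<le> t" and g: "0 < g" and \<eta>: "0 < \<eta>" "\<eta> < 1 / 2"
    and K: "\<And>\<tau>. 1 \<le> \<tau> \<Longrightarrow> \<tau> \<le> t \<Longrightarrow> \<bar>p \<tau>\<bar> \<le> K"
    and gap: "\<And>k. 1 \<le> k \<Longrightarrow> 2 * k \<le> t \<Longrightarrow> g * real (2 * k) powr (- \<eta>) \<le> \<bar>p (2 * k - 1) - p (2 * k)\<bar>"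
    and th: "th \<in> {amin..amax} \<times> {bmin..bmax}"
  defines "C \<equiv> 2 + (2 * K\<^sup>2 + 1) * 6 / g\<^sup>2"
  shows "(norm (est_link amin amax bmin bmax th th0 p e t - th))\<^sup>2
     \<le> 4 * C * (1 + C) * ridge_energy p e t / real t powr (1 - 2 * \<eta>)"
proof -
  define \<Psi> where "\<Psi> \<tau> = fst th - snd th * p \<tau> + e \<tau>" for \<tau>
  define x y where xy: "x = fst (ls_raw p \<Psi> t) - fst th" "y = snd (ls_raw p \<Psi> t) - snd th"
  define S where "S = (\<Sum>\<tau>=1..t. (x - y * p \<tau>)\<^sup>2)"
  define u v where uv: "u = (\<Sum>\<tau>=1..t. e \<tau>)" "v = (\<Sum>\<tau>=1..t. p \<tau> * e \<tau>)"
  define R where "R = ridge_energy p e t"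
  have "p 1 \<noteq> p 2"
  proof
    assume "p 1 = p 2"
    then have "g * 2 powr (- \<eta>) \<le> 0" using gap[of 1] t by simp
    then show False using g by (simp add: mult_le_0_iff not_le[symmetric])
  qed
  then have "lsq_err p \<Psi> t (ls_raw p \<Psi> t) \<le> lsq_err p \<Psi> t th"
    by (rule ls_raw_eq(2)[OF t])
  moreover have "lsq_err p \<Psi> t (ls_raw p \<Psi> t) = (\<Sum>\<tau>=1..t. (e \<tau> - (x - y * p \<tau>))\<^sup>2)"
    unfolding lsq_err_def by (intro sum.cong) (auto simp: \<Psi>_def xy algebra_simps)
  moreover have "\<dots> = (\<Sum>\<tau>=1..t. (e \<tau>)\<^sup>2) + S - 2 * (x * u - y * v)"
    by (simp add: S_def uv power2_eq_square algebra_simps sum.distrib sum_subtractf sum_distrib_left)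
  moreover have "lsq_err p \<Psi> t th = (\<Sum>\<tau>=1..t. (e \<tau>)\<^sup>2)"
    by (simp add: lsq_err_def \<Psi>_def)
  ultimately have S_le: "S \<le> 2 * (x * u - y * v)" by linarith
  have C: "0 < C" unfolding C_def by (intro add_pos_nonneg) auto
  have r: "1 \<le> real t powr (1 - 2 * \<eta>)"
    using t \<eta> by (intro ge_one_powr_ge_zero) auto
  have xyS: "(x\<^sup>2 + y\<^sup>2) * real t powr (1 - 2 * \<eta>) \<le> C * S"
    unfolding C_def S_def by (rule coefficients_le_sum_residuals[OF t g \<eta> K gap])
  \<comment> \<open>The power of \<open>t\<close> is at least 1, so the penalty from the identity in
    \<open>A\<close> costs at most \<open>C\<close> times the prediction error.\<close>
  have reg: "x\<^sup>2 + y\<^sup>2 \<le> C * S"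
    using xyS mult_left_mono[OF r, of "x\<^sup>2 + y\<^sup>2"] by simp
  txt \<open>Testing the variational inequality with \<open>s\<close> times the estimation error absorbs the
    regularisation; this \<open>s\<close> maximises \<open>s S - s\<^sup>2 (1 + C) S\<close>.\<close>
  define s where "s = 1 / (2 * (1 + C))"
  have s: "0 < s" "s * (1 + C) = 1 / 2" using C by (auto simp: s_def field_simps)
  have "s * S - s\<^sup>2 * (S + C * S) \<le> 2 * s * (x * u - y * v) - s\<^sup>2 * (S + (x\<^sup>2 + y\<^sup>2))"
  proof -
    have "s * S \<le> s * (2 * (x * u - y * v))" using S_le s by (intro mult_left_mono) auto
    then have "s * S \<le> 2 * s * (x * u - y * v)" by (simp only: mult_ac)
    moreover have "s\<^sup>2 * (S + (x\<^sup>2 + y\<^sup>2)) \<le> s\<^sup>2 * (S + C * S)" using reg by (intro mult_left_mono) auto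
    ultimately show ?thesis by linarith
  qed
  \<comment> \<open>The trial vector is \<open>(s * x, - s * y)\<close>; the minus sign matches
    demand decreasing in price.\<close>
  also have "\<dots> = 2 * (s * x * u + (- s * y) * v)
      - ((\<Sum>\<tau>=1..t. (s * x + (- s * y) * p \<tau>)\<^sup>2) + (s * x)\<^sup>2 + (- s * y)\<^sup>2)"
  proof -
    have "(\<Sum>\<tau>=1..t. (s * x + (- s * y) * p \<tau>)\<^sup>2) = s\<^sup>2 * S"
      unfolding S_def sum_distrib_left by (intro sum.cong) (auto simp: power2_eq_square algebra_simps)
    then show ?thesis by (simp add: algebra_simps power_mult_distrib)
  qed
  also have "\<dots> \<le> R" unfolding R_def uv by (rule ridge_energy_variational)
  finally have "s * S - s * (s * (1 + C)) * S \<le> R" by (simp add: power2_eq_square algebra_simps)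
  then have "s * S / 2 \<le> R" unfolding s(2) by (simp add: mult.commute)
  then have "S \<le> 4 * (1 + C) * R" using C by (simp add: s_def field_simps)
  then have "(x\<^sup>2 + y\<^sup>2) * real t powr (1 - 2 * \<eta>) \<le> C * (4 * (1 + C) * R)"
    using xyS mult_left_mono[of S "4 * (1 + C) * R" C] C by linarith
  then have "x\<^sup>2 + y\<^sup>2 \<le> 4 * C * (1 + C) * R / real t powr (1 - 2 * \<eta>)"
    using r by (subst le_divide_eq) (auto simp: algebra_simps)
  moreover have "(norm (est_link amin amax bmin bmax th th0 p e t - th))\<^sup>2 \<le> x\<^sup>2 + y\<^sup>2"
  proof -
    have "est_link amin amax bmin bmax th th0 p e t
        = (clip amin amax (fst (ls_raw p \<Psi> t)), clip bmin bmax (snd (ls_raw p \<Psi> t)))"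
      using t by (simp add: est_link_def \<Psi>_def[abs_def] Let_def)
    moreover have "\<bar>clip amin amax (fst (ls_raw p \<Psi> t)) - fst th\<bar> \<le> \<bar>x\<bar>"
      "\<bar>clip bmin bmax (snd (ls_raw p \<Psi> t)) - snd th\<bar> \<le> \<bar>y\<bar>"
      unfolding xy using th by (auto intro!: clip_contract)
    ultimately show ?thesis
      by (auto simp: norm_prod_def abs_le_square_iff intro!: add_mono)
  qed
  ultimately show ?thesis unfolding R_def by linarith
qed

section \<open>Independence of the past\<close>

definition preimages :: "'a measure \<Rightarrow> ('a \<Rightarrow> 'b) \<Rightarrow> 'b measure \<Rightarrow> 'a set set" where
  "preimages M X N = {X -` A \<inter> space M | A. A \<in> sets N}"

text \<open>The bound is strict: day \<open>t\<close> itself is excluded, so prices of day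
  \<open>t\<close> can be measurable here while its shocks are independent of it.\<close>

definition past :: "'a measure \<Rightarrow> (nat \<Rightarrow> 'a set set) \<Rightarrow> nat \<Rightarrow> 'a measure" where
  "past M E t = sigma (space M) (\<Union>d<t. E d)"

lemma Int_stable_preimages: "Int_stable (preimages M X N)"
proof (rule Int_stableI)
  fix a b assume "a \<in> preimages M X N" "b \<in> preimages M X N"
  then obtain A B where "a = X -` A \<inter> space M" "A \<in> sets N" "b = X -` B \<inter> space M" "B \<in> sets N"
    unfolding preimages_def by blast
  then have "a \<inter> b = X -` (A \<inter> B) \<inter> space M" "A \<inter> B \<in> sets N" by auto
  then show "a \<inter> b \<in> preimages M X N" unfolding preimages_def by blast
qed

lemma preimages_subset_sets:
  assumes "X \<in> measurable M N"
  shows "preimages M X N \<subseteq> sets M"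
  using assms unfolding preimages_def by (auto intro: measurable_sets)

lemma space_past [simp]: "space (past M E t) = space M"
  by (simp add: past_def space_measure_of_conv)

lemma sets_past:
  assumes "\<And>d. E d \<subseteq> sets M"
  shows "sets (past M E t) = sigma_sets (space M) (\<Union>d<t. E d)"
  unfolding past_def using assms sets.sets_into_space by (intro sets_measure_of) blast

lemma subalgebra_past:
  assumes "\<And>d. E d \<subseteq> sets M"
  shows "subalgebra M (past M E t)"
  unfolding subalgebra_def sets_past[of E, OF assms]
  using assms by (auto intro!: sets.sigma_sets_subset)

lemma sets_past_mono:
  assumes "\<And>d. E d \<subseteq> sets M" "s \<le> t"
  shows "sets (past M E s) \<subseteq> sets (past M E t)"
  unfolding sets_past[of E, OF assms(1)] using assms(2) by (intro sigma_sets_subseteq) fastforce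

lemma measurable_past:
  assumes "\<And>d. E d \<subseteq> sets M" "X \<in> measurable M N" "d < t" "E d = preimages M X N"
  shows "X \<in> measurable (past M E t) N"
proof (rule measurableI)
  fix A assume "A \<in> sets N"
  then have "X -` A \<inter> space M \<in> (\<Union>d<t. E d)" using assms(3,4) unfolding preimages_def by blast
  then show "X -` A \<inter> space (past M E t) \<in> sets (past M E t)"
    unfolding sets_past[of E, OF assms(1)] by (simp add: sigma_sets.Basic)
qed (use assms(2) in \<open>auto dest: measurable_space\<close>)

text \<open>Merges two hypotheses into one independent family, with the initial draw as day 0: first
  the draw is split off from the whole sequence, then the days factor among themselves.\<close>

lemma (in prob_space) indep_sets_initial_sequence:
  assumes X: "indep_vars (\<lambda>_. N) X {1::nat..}"
    and Y: "random_variable L Y"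
    and XY: "indep_set (preimages M Y L) (preimages M (\<lambda>\<omega>. \<lambda>d\<in>{1..}. X d \<omega>) (PiM {1..} (\<lambda>_. N)))"
  shows "indep_sets (\<lambda>d. if d = 0 then preimages M Y L else preimages M (X d) N) UNIV"
    (is "indep_sets ?E _")
proof (rule indep_setsI)
  have X': "indep_sets (\<lambda>d. preimages M (X d) N) {1..}" and rv: "\<And>d. 1 \<le> d \<Longrightarrow> random_variable N (X d)"
    using X unfolding indep_vars_def2 preimages_def by auto
  show "?E d \<subseteq> events" for d
    using preimages_subset_sets[OF Y] preimages_subset_sets[OF rv[of d]] by (cases "d = 0") simp_all
  fix A J assume J: "J \<noteq> {}" "J \<subseteq> UNIV" "finite J" and A: "\<forall>j\<in>J. A j \<in> ?E j"
  define I where "I = J - {0}"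
  have I: "I \<subseteq> {1..}" "finite I" "\<forall>j\<in>I. A j \<in> preimages M (X j) N" using J A by (auto simp: I_def)
  have prodI: "prob (\<Inter>j\<in>I. A j) = (\<Prod>j\<in>I. prob (A j))" if "I \<noteq> {}"
    by (rule indep_setsD[OF X' I(1) that I(2,3)])
  show "prob (\<Inter>j\<in>J. A j) = (\<Prod>j\<in>J. prob (A j))"
  proof (cases "0 \<in> J")
    case False
    then have "I = J" by (auto simp: I_def)
    then show ?thesis using prodI J by simp
  next
    case True
    then have J_eq: "J = insert 0 I" "0 \<notin> I" by (auto simp: I_def)
    show ?thesis
    proof (cases "I = {}")
      case True
      then show ?thesis using J_eq by simp
    next
      case False
      have "\<forall>j\<in>I. \<exists>C. A j = X j -` C \<inter> space M \<and> C \<in> sets N"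
        using I(3) unfolding preimages_def by blast
      from bchoice[OF this] obtain B
        where B: "\<And>j. j \<in> I \<Longrightarrow> A j = X j -` B j \<inter> space M \<and> B j \<in> sets N"
        by blast
      \<comment> \<open>A finite intersection of day events is a cylinder for the whole sequence,
        the form in which independence from the draw is assumed.\<close>
      define Z where "Z = {x \<in> space (PiM {1..} (\<lambda>_. N)). \<forall>j\<in>I. x j \<in> B j}"
      have "Z \<in> sets (PiM {1..} (\<lambda>_. N))"
        unfolding Z_def using B I(1,2)
        by (intro sets.sets_Collect_finite_All sets_Collect_single) auto
      moreover have "(\<Inter>j\<in>I. A j) = (\<lambda>\<omega>. \<lambda>d\<in>{1..}. X d \<omega>) -` Z \<inter> space M"
      proof (rule set_eqI)
        fix \<omega>
        have "(\<lambda>d\<in>{1..}. X d \<omega>) \<in> space (PiM {1..} (\<lambda>_. N))" if "\<omega> \<in> space M"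
          unfolding space_PiM using that rv by (auto dest: measurable_space)
        moreover have "(\<lambda>d\<in>{1..}. X d \<omega>) j = X j \<omega>" if "j \<in> I" for j
          using that I(1) by auto
        moreover have "\<omega> \<in> (\<Inter>j\<in>I. A j) \<longleftrightarrow> \<omega> \<in> space M \<and> (\<forall>j\<in>I. X j \<omega> \<in> B j)"
          using B False by auto
        ultimately show "\<omega> \<in> (\<Inter>j\<in>I. A j) \<longleftrightarrow> \<omega> \<in> (\<lambda>\<omega>. \<lambda>d\<in>{1..}. X d \<omega>) -` Z \<inter> space M"
          unfolding Z_def by auto
      qed
      ultimately have "(\<Inter>j\<in>I. A j) \<in> preimages M (\<lambda>\<omega>. \<lambda>d\<in>{1..}. X d \<omega>) (PiM {1..} (\<lambda>_. N))"
        unfolding preimages_def by blast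
      moreover have "A 0 \<in> preimages M Y L" using A True by auto
      ultimately have "prob (A 0 \<inter> (\<Inter>j\<in>I. A j)) = prob (A 0) * prob (\<Inter>j\<in>I. A j)"
        by (intro indep_setD[OF XY])
      then show ?thesis using J_eq prodI[OF False] I(2) by simp
    qed
  qed
qed

text \<open>Grouping the independent family into the blocks \<open>{t}\<close> and
  \<open>{..<t}\<close> makes \<open>f\<close> and \<open>G\<close> independent, so the expectation
  of the product factors.\<close>

lemma (in prob_space) expectation_mult_past:
  fixes f G :: "'a \<Rightarrow> real"
  assumes E: "indep_sets E UNIV" "\<And>d. Int_stable (E d)"
    and f: "integrable M f" "preimages M f borel \<subseteq> E t"
    and G: "integrable M G" "G \<in> borel_measurable (past M E t)"
  shows "expectation (\<lambda>\<omega>. f \<omega> * G \<omega>) = expectation f * expectation G"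
proof (rule indep_var_lebesgue_integral[OF _ f(1) G(1)])
  have ev: "E d \<subseteq> events" for d using E(1) by (auto simp: indep_sets_def)
  let ?I = "case_bool {t} {..<t}"
  have "indep_sets (\<lambda>j. sigma_sets (space M) (\<Union>i\<in>?I j. E i)) UNIV"
  proof (rule indep_sets_collect_sigma)
    show "indep_sets E (\<Union>j\<in>UNIV. ?I j)" by (rule indep_sets_mono_index[OF subset_UNIV E(1)])
    show "disjoint_family_on ?I UNIV" by (auto simp: disjoint_family_on_def split: bool.splits)
  qed (rule E(2))
  then have "indep_set (sigma_sets (space M) (E t)) (sigma_sets (space M) (\<Union>d<t. E d))"
    unfolding indep_set_def by (rule indep_sets_mono_sets) (auto split: bool.splits)
  moreover have "sigma_sets (space M) (preimages M f borel) \<subseteq> sigma_sets (space M) (E t)"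
    using f(2) by (rule sigma_sets_mono')
  moreover have "sigma_sets (space M) (preimages M G borel) \<subseteq> sigma_sets (space M) (\<Union>d<t. E d)"
  proof (rule sigma_sets_mono)
    show "preimages M G borel \<subseteq> sigma_sets (space M) (\<Union>d<t. E d)"
      using measurable_sets[OF G(2)] sets_past[of E, OF ev, of t] unfolding preimages_def by auto
  qed
  ultimately have "indep_set (sigma_sets (space M) (preimages M f borel)) (sigma_sets (space M) (preimages M G borel))"
    unfolding indep_sets2_eq by blast
  then show "indep_var borel f borel G"
    unfolding indep_var_eq preimages_def using f(1) G(1) by auto
qed

section \<open>Boundedness of optimal prices\<close>

text \<open>Profit is a concave quadratic in the price. Its linear part is at most \<open>R\<close>
  times the absolute price, and AM-GM absorbs this into half of the quadratic term.\<close>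

lemma link_profit_le:
  fixes a b m p c :: real
  assumes a: "0 \<le> a" "a \<le> amax" and b: "0 < bmin" "bmin \<le> b" "b \<le> bmax" and m: "\<bar>m\<bar> \<le> B" and c: "0 \<le> c"
  defines "R \<equiv> amax + B + bmax * c"
  shows "(a - b * p + m) * p - (a - b * p) * c \<le> R\<^sup>2 / (2 * bmin) - bmin / 2 * p\<^sup>2"
proof -
  have "\<bar>a + m + b * c\<bar> \<le> R"
    unfolding R_def using a m b c mult_right_mono[of b bmax c] mult_nonneg_nonneg[of b c] by linarith
  then have "\<bar>a + m + b * c\<bar> * \<bar>p\<bar> \<le> R * \<bar>p\<bar>" by (rule mult_right_mono) simp
  then have 1: "(a + m + b * c) * p \<le> R * \<bar>p\<bar>" unfolding abs_mult[symmetric] by linarith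
  have 2: "bmin * p\<^sup>2 \<le> b * p\<^sup>2" using b by (intro mult_right_mono) auto
  have 3: "0 \<le> c * a" using a c by simp
  have "0 \<le> (R - bmin * \<bar>p\<bar>)\<^sup>2 / (2 * bmin)" using b by simp
  also have "\<dots> = R\<^sup>2 / (2 * bmin) + bmin / 2 * \<bar>p\<bar>\<^sup>2 - R * \<bar>p\<bar>"
    using b by (simp add: field_simps power2_eq_square)
  finally have 4: "R * \<bar>p\<bar> \<le> R\<^sup>2 / (2 * bmin) + bmin / 2 * p\<^sup>2" by simp
  have "(a - b * p + m) * p - (a - b * p) * c = (a + m + b * c) * p - b * p\<^sup>2 - c * a"
    by (simp add: algebra_simps power2_eq_square)
  with 1 2 3 4 show ?thesis by linarith
qed

text \<open>The supply constraint turns the minimum into \<open>w l + min e 0\<close>, so the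
  expected shortage no longer depends on the price.\<close>

lemma objective_feasible:
  assumes D: "\<And>l. l \<in> links \<Longrightarrow> prob_space (D l) \<and> sets (D l) = sets borel \<and> (AE e in D l. \<bar>e\<bar> \<le> B)"
    and w: "\<And>l. l \<in> links \<Longrightarrow> w l = fst (thh l) - snd (thh l) * p l"
  shows "objective xi c D thh p w =
    (\<Sum>l\<in>links. xi l * ((w l + (\<integral>e. min e 0 \<partial>(D l))) * p l - w l * c))"
proof -
  have "(\<integral>e. min (fst (thh l) - snd (thh l) * p l + e) (w l) \<partial>(D l)) = w l + (\<integral>e. min e 0 \<partial>(D l))"
    if l: "l \<in> links" for l
  proof -
    interpret prob_space "D l" using D[OF l] by simp
    have sets: "sets (D l) = sets borel" using D[OF l] by simp
    have "integrable (D l) (\<lambda>e. min e 0)"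
    proof (rule integrable_const_bound[where B = B])
      show "AE e in D l. norm (min e 0) \<le> B" using D[OF l] by (auto elim!: eventually_mono)
    qed (simp add: measurable_cong_sets[OF sets refl])
    then have "(\<integral>e. w l + min e 0 \<partial>(D l)) = w l + (\<integral>e. min e 0 \<partial>(D l))"
      by (simp add: prob_space)
    moreover have "min (fst (thh l) - snd (thh l) * p l + e) (w l) = w l + min e 0" for e
      using w[OF l] by (simp add: min_def)
    ultimately show ?thesis by simp
  qed
  then show ?thesis
    unfolding objective_def sum_subtractf[symmetric]
    by (intro sum.cong) (auto simp: algebra_simps)
qed

text \<open>The constraints bound prices only from above, and flow balance might call for large
  supply on a link at a very negative price. Optimality excludes this, uniformly over the estimate
  box.\<close>

lemma optimal_prices_bounded:
  fixes xi :: "'loc::finite \<times> 'loc \<Rightarrow> real"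
  assumes bounds: "0 < amin" "amin \<le> amax" "0 < bmin" "bmin \<le> bmax"
    and xi: "\<And>l. l \<in> links \<Longrightarrow> 0 < xi l" and cost: "0 < c" "c < pmax"
    and D: "\<And>l. l \<in> links \<Longrightarrow> prob_space (D l) \<and> sets (D l) = sets borel \<and> (AE e in D l. \<bar>e\<bar> \<le> B)"
  shows "\<exists>K\<ge>0. \<forall>thh p w l. (\<forall>l\<in>links. thh l \<in> {amin..amax} \<times> {bmin..bmax}) \<longrightarrow>
    optimal xi c pmax D thh p w \<longrightarrow> l \<in> links \<longrightarrow> \<bar>p l\<bar> \<le> K"
proof -
  txt \<open>The competitor supplies \<open>amax\<close> on every link: it balances all flows and its prices are
    bounded, while the profit of an optimal solution decreases quadratically in each price.\<close>
  define m where "m l = (\<integral>e. min e 0 \<partial>(D l))" for l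
  define B' where "B' = (\<Sum>l\<in>(links :: ('loc \<times> 'loc) set). \<bar>m l\<bar>)"
  have m: "\<bar>m l\<bar> \<le> B'" if "l \<in> links" for l
    unfolding B'_def using that by (intro member_le_sum) auto
  have B': "0 \<le> B'" unfolding B'_def by (intro sum_nonneg) simp
  define R where "R = amax + B' + bmax * c"
  define U where "U = R\<^sup>2 / (2 * bmin)"
  define L where "L = (amax + B') * ((amax - amin) / bmin) + amax * c"
  define \<Xi> where "\<Xi> = (\<Sum>l\<in>(links :: ('loc \<times> 'loc) set). xi l)"
  define Y where "Y = (\<Sum>l\<in>(links :: ('loc \<times> 'loc) set). 1 / xi l)"
  define X where "X = \<Xi> * (U + L) * 2 / bmin"
  have "0 \<le> L" "0 \<le> U"
    unfolding L_def U_def using bounds cost B' by (auto intro!: add_nonneg_nonneg mult_nonneg_nonneg)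
  moreover have "0 \<le> \<Xi>" "0 \<le> Y"
    unfolding \<Xi>_def Y_def by (auto intro!: sum_nonneg dest: xi less_imp_le)
  ultimately have nonneg: "0 \<le> L" "0 \<le> U" "0 \<le> \<Xi>" "0 \<le> Y" .
  then have X: "0 \<le> X" unfolding X_def using bounds by simp
  have "\<bar>p l\<bar> \<le> 1 + X * Y"
    if box: "\<forall>l\<in>links. thh l \<in> {amin..amax} \<times> {bmin..bmax}"
      and opt: "optimal xi c pmax D thh p w" and l: "l \<in> links" for thh p w l
  proof -
    \<comment> \<open>The price at which estimated demand equals \<open>amax\<close>; it is
      nonpositive, hence below \<open>pmax\<close>.\<close>
    define q where "q l = (fst (thh l) - amax) / snd (thh l)" for l
    have ab: "amin \<le> fst (thh l)" "fst (thh l) \<le> amax" "bmin \<le> snd (thh l)" "snd (thh l) \<le> bmax"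
      if "l \<in> links" for l
      using bspec[OF box that] by auto
    have q: "q l \<le> 0" "- ((amax - amin) / bmin) \<le> q l" "amax = fst (thh l) - snd (thh l) * q l"
      if "l \<in> links" for l
    proof -
      note ab = ab[OF that]
      have "(amax - fst (thh l)) / snd (thh l) \<le> (amax - amin) / bmin"
        using ab bounds by (intro frac_le) auto
      then show "- ((amax - amin) / bmin) \<le> q l" by (simp add: q_def diff_divide_distrib)
      show "q l \<le> 0" unfolding q_def using ab bounds by (simp add: divide_le_0_iff)
      show "amax = fst (thh l) - snd (thh l) * q l" unfolding q_def using ab bounds by simp
    qed
    have "feasible pmax thh q (\<lambda>_. amax)"
      unfolding feasible_def
    proof (intro conjI allI ballI)
      fix l :: "'loc \<times> 'loc" assume "l \<in> links"
      note q = q[OF this]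
      show "amax = fst (thh l) - snd (thh l) * q l" by (rule q(3))
      show "q l \<le> pmax" using q(1) cost by linarith
      show "0 \<le> amax" using bounds by linarith
    qed simp
    then have opt_q: "objective xi c D thh q (\<lambda>_. amax) \<le> objective xi c D thh p w"
      using opt unfolding optimal_def by blast
    have obj_q: "objective xi c D thh q (\<lambda>_. amax) = (\<Sum>l\<in>links. xi l * ((amax + m l) * q l - amax * c))"
      unfolding m_def by (rule objective_feasible[OF D q(3)])
    have ge_q: "(\<Sum>l\<in>links. xi l * (- L)) \<le> (\<Sum>l\<in>links. xi l * ((amax + m l) * q l - amax * c))"
    proof (intro sum_mono mult_left_mono)
      fix l :: "'loc \<times> 'loc" assume l: "l \<in> links"
      have "\<bar>amax + m l\<bar> * \<bar>q l\<bar> \<le> (amax + B') * ((amax - amin) / bmin)"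
        using m[OF l] q[OF l] bounds B' by (intro mult_mono) auto
      then show "- L \<le> (amax + m l) * q l - amax * c"
        unfolding L_def abs_mult[symmetric] by linarith
    qed (use xi in \<open>auto intro: less_imp_le\<close>)
    have sum_L: "(\<Sum>l\<in>links. xi l * (- L)) = - \<Xi> * L"
      unfolding \<Xi>_def by (simp add: sum_distrib_right sum_negf)
    have w: "w l = fst (thh l) - snd (thh l) * p l" if "l \<in> links" for l
      using opt that unfolding optimal_def feasible_def by blast
    have obj_p: "objective xi c D thh p w = (\<Sum>l\<in>links. xi l * ((w l + m l) * p l - w l * c))"
      unfolding m_def by (rule objective_feasible[OF D w])
    have profit: "(w l + m l) * p l - w l * c \<le> U - bmin / 2 * (p l)\<^sup>2" if "l \<in> links" for l
      unfolding U_def R_def w[OF that]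
      using ab[OF that] bounds m[OF that] cost by (intro link_profit_le) auto
    \<comment> \<open>The quadratic loss is kept on link \<open>l\<close> alone and dropped
      elsewhere, so the total profit bound controls this one price.\<close>
    have "(\<Sum>k\<in>links. xi k * ((w k + m k) * p k - w k * c))
        \<le> (\<Sum>k\<in>links. xi k * U - (if k = l then xi l * (bmin / 2 * (p l)\<^sup>2) else 0))"
    proof (rule sum_mono)
      fix k :: "'loc \<times> 'loc" assume k: "k \<in> links"
      have "xi k * ((w k + m k) * p k - w k * c) \<le> xi k * (U - bmin / 2 * (p k)\<^sup>2)"
        using profit[OF k] xi[OF k] by (intro mult_left_mono) auto
      moreover have "0 \<le> xi k * (bmin / 2 * (p k)\<^sup>2)" using xi[OF k] bounds by simp
      ultimately show "xi k * ((w k + m k) * p k - w k * c)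
          \<le> xi k * U - (if k = l then xi l * (bmin / 2 * (p l)\<^sup>2) else 0)"
        by (auto simp: right_diff_distrib)
    qed
    also have "\<dots> = \<Xi> * U - xi l * (bmin / 2 * (p l)\<^sup>2)"
      using l unfolding \<Xi>_def by (simp add: sum_subtractf sum_distrib_right)
    finally have "- \<Xi> * L \<le> \<Xi> * U - xi l * (bmin / 2 * (p l)\<^sup>2)"
      using opt_q obj_q ge_q sum_L obj_p by linarith
    then have *: "xi l * (bmin / 2 * (p l)\<^sup>2) \<le> \<Xi> * (U + L)"
      by (simp add: distrib_left)
    have "(p l)\<^sup>2 \<le> X * (1 / xi l)"
    proof -
      have "(p l)\<^sup>2 = xi l * (bmin / 2 * (p l)\<^sup>2) * (2 / (bmin * xi l))"
        using xi[OF l] bounds by simp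
      also have "\<dots> \<le> \<Xi> * (U + L) * (2 / (bmin * xi l))"
        using * xi[OF l] bounds by (intro mult_right_mono) auto
      also have "\<dots> = X * (1 / xi l)" unfolding X_def by simp
      finally show ?thesis .
    qed
    also have "\<dots> \<le> X * Y"
      unfolding Y_def using l xi X by (intro mult_left_mono member_le_sum) (auto intro: less_imp_le)
    \<comment> \<open>Avoids a square root: a nonnegative number is at most the square of one plus
      itself.\<close>
    also have "\<dots> \<le> (1 + X * Y)\<^sup>2"
      using mult_nonneg_nonneg[OF X nonneg(4)] zero_le_power2[of "X * Y"] unfolding power2_sum by simp
    finally have "\<bar>p l\<bar> \<le> \<bar>1 + X * Y\<bar>" unfolding abs_le_square_iff .
    then show ?thesis using mult_nonneg_nonneg[OF X nonneg(4)] by simp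
  qed
  moreover have "0 \<le> 1 + X * Y" using X nonneg by simp
  ultimately show ?thesis by blast
qed

section \<open>The NRPS policy\<close>

text \<open>Independence is between days, for the vector over all links; shocks of one day may be
  dependent across links.\<close>

locale nrps_model = prob_space M
  for M :: "'a measure" +
  fixes theta :: "'loc::finite \<times> 'loc \<Rightarrow> real \<times> real"
    and xi :: "'loc \<times> 'loc \<Rightarrow> real"
    and c pmax amin amax bmin bmax elo ehi :: real
    and D :: "'loc \<times> 'loc \<Rightarrow> real measure"
    and eps :: "nat \<Rightarrow> 'loc \<times> 'loc \<Rightarrow> 'a \<Rightarrow> real"
    and theta0 :: "'a \<Rightarrow> 'loc \<times> 'loc \<Rightarrow> real \<times> real"
    and popt wopt :: "('loc \<times> 'loc \<Rightarrow> real \<times> real) \<Rightarrow> 'loc \<times> 'loc \<Rightarrow> real"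
  assumes bounds: "0 < amin" "amin \<le> amax" "0 < bmin" "bmin \<le> bmax"
    and theta_box: "\<forall>l\<in>links. theta l \<in> {amin..amax} \<times> {bmin..bmax}"
    and xi_pos: "\<forall>l\<in>links. 0 < xi l"
    and cost: "0 < c" "c < pmax"
    and shocks: "\<forall>d\<ge>1. \<forall>l\<in>links. eps d l \<in> borel_measurable M \<and>
                   (\<forall>\<omega>\<in>space M. eps d l \<omega> \<in> {elo..ehi}) \<and> distr M borel (eps d l) = D l"
    and shock_mean: "\<forall>l\<in>links. (\<integral>x. x \<partial>(D l)) = 0"
    and shocks_indep: "indep_vars (\<lambda>_. PiM links (\<lambda>_. borel)) (\<lambda>d \<omega>. \<lambda>l\<in>links. eps d l \<omega>) {1..}"
    and init_box: "\<forall>\<omega>\<in>space M. \<forall>l\<in>links. theta0 \<omega> l \<in> {amin..amax} \<times> {bmin..bmax}"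
    and init_rv: "(\<lambda>\<omega>. \<lambda>l\<in>links. theta0 \<omega> l) \<in> measurable M (PiM links (\<lambda>_. borel))"
    and init_indep: "indep_set
        {(\<lambda>\<omega>. \<lambda>l\<in>links. theta0 \<omega> l) -` A \<inter> space M | A. A \<in> sets (PiM links (\<lambda>_. borel))}
        {(\<lambda>\<omega>. \<lambda>d\<in>{1..}. \<lambda>l\<in>links. eps d l \<omega>) -` A \<inter> space M
           | A. A \<in> sets (PiM {1..} (\<lambda>_. PiM links (\<lambda>_. borel)))}"
    and opt_sel: "\<forall>thh. (\<forall>l\<in>links. thh l \<in> {amin..amax} \<times> {bmin..bmax}) \<longrightarrow>
                     optimal xi c pmax D thh (popt thh) (wopt thh)"
    and opt_meas: "\<forall>l\<in>links. (\<lambda>thh. popt thh l) \<in> borel_measurable (PiM links (\<lambda>_. borel))"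
begin

definition events_of_day :: "nat \<Rightarrow> 'a set set" where
  "events_of_day d = (if d = 0 then preimages M (\<lambda>\<omega>. \<lambda>l\<in>links. theta0 \<omega> l) (PiM links (\<lambda>_. borel))
     else preimages M (\<lambda>\<omega>. \<lambda>l\<in>links. eps d l \<omega>) (PiM links (\<lambda>_. borel)))"

abbreviation history :: "nat \<Rightarrow> 'a measure" where
  "history \<equiv> past M events_of_day"

abbreviation est :: "(nat \<Rightarrow> 'a \<Rightarrow> 'loc \<times> 'loc \<Rightarrow> real) \<Rightarrow> nat \<Rightarrow> 'a \<Rightarrow> 'loc \<times> 'loc \<Rightarrow> real \<times> real" where
  "est \<equiv> nrps_est amin amax bmin bmax theta theta0 eps"

definition shock_bound :: real where
  "shock_bound = max \<bar>elo\<bar> \<bar>ehi\<bar>"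

lemma indep_days: "indep_sets events_of_day UNIV"
  unfolding events_of_day_def[abs_def]
  by (rule indep_sets_initial_sequence[OF shocks_indep init_rv]) (use init_indep in \<open>simp only: preimages_def\<close>)

lemma events_of_day_subset: "events_of_day d \<subseteq> events"
  using indep_days by (auto simp: indep_sets_def)

lemma Int_stable_events_of_day: "Int_stable (events_of_day d)"
  unfolding events_of_day_def by (simp add: Int_stable_preimages)

lemma shock_abs_le:
  assumes "1 \<le> d" "l \<in> links" "\<omega> \<in> space M"
  shows "\<bar>eps d l \<omega>\<bar> \<le> shock_bound"
proof -
  have "eps d l \<omega> \<in> {elo..ehi}" using shocks assms by blast
  then show ?thesis by (auto simp: shock_bound_def)
qed

lemma shocks_rv: "1 \<le> d \<Longrightarrow> (\<lambda>\<omega>. \<lambda>l\<in>links. eps d l \<omega>) \<in> measurable M (PiM links (\<lambda>_. borel))"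
  using shocks by (intro measurable_restrict) auto

lemma shock_measurable_history:
  assumes "1 \<le> d" "d < t" "l \<in> links"
  shows "eps d l \<in> borel_measurable (history t)"
proof -
  have "(\<lambda>\<omega>. \<lambda>l\<in>links. eps d l \<omega>) \<in> measurable (history t) (PiM links (\<lambda>_. borel))"
    using assms by (intro measurable_past[OF events_of_day_subset shocks_rv]) (auto simp: events_of_day_def)
  from measurable_compose[OF this measurable_component_singleton[OF assms(3)]]
  show ?thesis using assms(3) by simp
qed

lemma init_measurable_history:
  assumes "0 < t" "l \<in> links"
  shows "(\<lambda>\<omega>. theta0 \<omega> l) \<in> borel_measurable (history t)"
proof -
  have "(\<lambda>\<omega>. \<lambda>l\<in>links. theta0 \<omega> l) \<in> measurable (history t) (PiM links (\<lambda>_. borel))"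
    using assms by (intro measurable_past[OF events_of_day_subset init_rv, of 0]) (auto simp: events_of_day_def)
  from measurable_compose[OF this measurable_component_singleton[OF assms(2)]]
  show ?thesis using assms(2) by simp
qed

lemma shock_orthogonal:
  assumes t: "1 \<le> t" and l: "l \<in> links" and G: "bounded_rv (history t) G"
  shows "expectation (\<lambda>\<omega>. eps t l \<omega> * G \<omega>) = 0"
proof -
  have meas: "eps t l \<in> borel_measurable M" and dist: "distr M borel (eps t l) = D l"
    using shocks t l by auto
  have int: "integrable M (eps t l)"
    using meas shock_abs_le[OF t l] by (intro bounded_rv_integrable bounded_rvI)
  have "expectation (eps t l) = (\<integral>x. x \<partial>(distr M borel (eps t l)))"
    using meas by (subst integral_distr) auto
  then have mean: "expectation (eps t l) = 0" using dist shock_mean l by simp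
  have "preimages M (eps t l) borel \<subseteq> events_of_day t"
  proof
    fix a assume "a \<in> preimages M (eps t l) borel"
    then obtain A where A: "A \<in> sets borel" "a = eps t l -` A \<inter> space M" unfolding preimages_def by blast
    define Z where "Z = (\<lambda>x. x l) -` A \<inter> space (PiM links (\<lambda>_. borel :: real measure))"
    have "Z \<in> sets (PiM links (\<lambda>_. borel))"
      unfolding Z_def by (rule measurable_sets[OF measurable_component_singleton[OF l] A(1)])
    moreover have "a = (\<lambda>\<omega>. \<lambda>l\<in>links. eps t l \<omega>) -` Z \<inter> space M"
      unfolding A(2) Z_def using l by (auto simp: space_PiM)
    ultimately have "a \<in> preimages M (\<lambda>\<omega>. \<lambda>l\<in>links. eps t l \<omega>) (PiM links (\<lambda>_. borel))"
      unfolding preimages_def by blast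
    then show "a \<in> events_of_day t" unfolding events_of_day_def using t by simp
  qed
  moreover have "integrable M G"
    using bounded_rv_subalgebra[OF subalgebra_past[OF events_of_day_subset] G] by (rule bounded_rv_integrable)
  moreover have "G \<in> borel_measurable (history t)" using G by (simp add: bounded_rv_def)
  ultimately show ?thesis
    using expectation_mult_past[OF indep_days Int_stable_events_of_day int] mean by simp
qed

text \<open>The support of \<open>D l\<close> is read off from day 1, whose shock has this
  distribution.\<close>

lemma popt_bounded:
  "\<exists>K\<ge>0. \<forall>thh l. (\<forall>l\<in>links. thh l \<in> {amin..amax} \<times> {bmin..bmax}) \<longrightarrow> l \<in> links \<longrightarrow> \<bar>popt thh l\<bar> \<le> K"
proof -
  have "prob_space (D l) \<and> sets (D l) = sets borel \<and> (AE e in D l. \<bar>e\<bar> \<le> shock_bound)" if l: "l \<in> links" for l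
  proof -
    have D: "eps 1 l \<in> borel_measurable M" "distr M borel (eps 1 l) = D l" using shocks l by auto
    have "AE e in distr M borel (eps 1 l). \<bar>e\<bar> \<le> shock_bound"
      using D(1) shock_abs_le[of 1 l] l by (subst AE_distr_iff) auto
    moreover have "prob_space (distr M borel (eps 1 l))" using D(1) by (rule prob_space_distr)
    ultimately show ?thesis unfolding D(2)[symmetric] by simp
  qed
  then obtain K where "0 \<le> K" and K: "\<And>thh p w l. \<forall>l\<in>links. thh l \<in> {amin..amax} \<times> {bmin..bmax} \<Longrightarrow>
      optimal xi c pmax D thh p w \<Longrightarrow> l \<in> links \<Longrightarrow> \<bar>p l\<bar> \<le> K"
    using optimal_prices_bounded[OF bounds _ cost, of xi D shock_bound] xi_pos by blast
  have "\<bar>popt thh l\<bar> \<le> K" if "\<forall>l\<in>links. thh l \<in> {amin..amax} \<times> {bmin..bmax}" "l \<in> links" for thh l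
    by (rule K[OF that(1) opt_sel[rule_format, OF that(1)[rule_format]] that(2)])
  then show ?thesis using \<open>0 \<le> K\<close> by blast
qed

text \<open>Clipping ensures this whatever \<open>ls_raw\<close> selects, even when minimisers are
  not unique.\<close>

lemma est_in_box:
  assumes "\<omega> \<in> space M" "l \<in> links"
  shows "est P t \<omega> l \<in> {amin..amax} \<times> {bmin..bmax}"
proof -
  have "theta0 \<omega> l \<in> {amin..amax} \<times> {bmin..bmax}" using init_box assms by blast
  then show ?thesis
    using assms(2) clip_in_interval[OF bounds(2)] clip_in_interval[OF bounds(4)]
    by (simp add: nrps_est_def est_link_def Let_def)
qed

context
  fixes rho eta K0 :: real and P W :: "nat \<Rightarrow> 'a \<Rightarrow> 'loc \<times> 'loc \<Rightarrow> real"
  assumes rho: "0 < rho" and eta: "0 < eta" "eta < 1 / 2"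
    and policy: "nrps_policy M amin amax bmin bmax theta theta0 eps popt wopt rho eta P W"
    and K0: "\<And>thh l. (\<forall>l\<in>links. thh l \<in> {amin..amax} \<times> {bmin..bmax}) \<Longrightarrow> l \<in> links \<Longrightarrow> \<bar>popt thh l\<bar> \<le> K0"
begin

lemma price_odd:
  assumes "odd d" "l \<in> links" "\<omega> \<in> space M"
  shows "P d \<omega> l = popt (est P (d - 1) \<omega>) l"
  using policy assms unfolding nrps_policy_def by (auto simp: odd_pos Suc_leI)

lemma price_even:
  assumes "even d" "1 \<le> d" "l \<in> links" "\<omega> \<in> space M"
  shows "P d \<omega> l = popt (est P (d - 2) \<omega>) l - rho / snd (est P (d - 2) \<omega> l) * real d powr (- eta)"
  using policy assms unfolding nrps_policy_def by blast

text \<open>Days \<open>2 * k - 1\<close> and \<open>2 * k\<close> use the same estimate, with index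
  \<open>2 * k - 2\<close>; the optimal prices cancel and exactly the perturbation remains.\<close>

lemma price_gap:
  assumes k: "1 \<le> k" and l: "l \<in> links" and \<omega>: "\<omega> \<in> space M"
  shows "rho / bmax * real (2 * k) powr (- eta) \<le> \<bar>P (2 * k - 1) \<omega> l - P (2 * k) \<omega> l\<bar>"
proof -
  let ?b = "snd (est P (2 * k - 2) \<omega> l)"
  have b: "bmin \<le> ?b" "?b \<le> bmax" using est_in_box[OF \<omega> l, of P "2 * k - 2"] by auto
  have "P (2 * k - 1) \<omega> l = popt (est P (2 * k - 2) \<omega>) l"
  proof -
    have "odd (2 * k - 1)" "2 * k - 1 - 1 = 2 * k - 2" using k by auto
    then show ?thesis using price_odd[of "2 * k - 1" l \<omega>] l \<omega> by simp
  qed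
  then have diff: "P (2 * k - 1) \<omega> l - P (2 * k) \<omega> l = rho / ?b * real (2 * k) powr (- eta)"
    using price_even[of "2 * k" l \<omega>] k l \<omega> by simp
  have "rho / bmax * real (2 * k) powr (- eta) \<le> rho / ?b * real (2 * k) powr (- eta)"
    using b bounds rho by (intro mult_right_mono divide_left_mono) auto
  then show ?thesis unfolding diff by (rule order_trans[OF _ abs_ge_self])
qed

lemma price_abs_le:
  assumes "1 \<le> d" "l \<in> links" "\<omega> \<in> space M"
  shows "\<bar>P d \<omega> l\<bar> \<le> K0 + rho / bmin"
proof -
  have p: "\<bar>popt (est P t \<omega>) l\<bar> \<le> K0" for t
    using est_in_box assms by (intro K0) auto
  show ?thesis
  proof (cases "odd d")
    case True
    then have "\<bar>P d \<omega> l\<bar> \<le> K0" using price_odd assms p by simp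
    moreover have "0 \<le> rho / bmin" using rho bounds by simp
    ultimately show ?thesis by linarith
  next
    case False
    let ?b = "snd (est P (d - 2) \<omega> l)"
    have b: "bmin \<le> ?b" using est_in_box[OF assms(3,2), of P "d - 2"] by auto
    have "rho / ?b * real d powr (- eta) \<le> rho / bmin * 1"
      using b bounds rho eta assms(1) powr_mono[of "- eta" 0 "real d"]
      by (intro mult_mono divide_left_mono) auto
    moreover have "0 \<le> rho / ?b * real d powr (- eta)" using b bounds rho by simp
    ultimately show ?thesis
      using p[of "d - 2"] price_even[of d l \<omega>] False assms by (simp add: abs_le_iff)
  qed
qed

lemma first_prices_differ:
  assumes "l \<in> links" "\<omega> \<in> space M"
  shows "P 1 \<omega> l \<noteq> P 2 \<omega> l"
proof -
  have "0 < rho / bmax * 2 powr (- eta)" using rho bounds by simp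
  then show ?thesis using price_gap[of 1 l \<omega>] assms by auto
qed

text \<open>For \<open>t = 1\<close> the least-squares problem is degenerate and the estimate an arbitrary choice, which
  need not be measurable; the policy never uses it.\<close>

lemma est_measurable_history:
  assumes P: "\<And>d l. 1 \<le> d \<Longrightarrow> d \<le> t \<Longrightarrow> l \<in> links \<Longrightarrow> (\<lambda>\<omega>. P d \<omega> l) \<in> borel_measurable (history d)"
    and t: "t \<noteq> 1" and l: "l \<in> links"
  shows "(\<lambda>\<omega>. est P t \<omega> l) \<in> borel_measurable (history (Suc t))"
proof (cases "t = 0")
  case True
  have "(\<lambda>\<omega>. theta0 \<omega> l) \<in> borel_measurable (history (Suc t))"
    using l by (intro init_measurable_history) auto
  then show ?thesis using l True by (simp add: nrps_est_def est_link_def)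
next
  case False
  define \<Psi> where "\<Psi> \<omega> \<tau> = fst (theta l) - snd (theta l) * P \<tau> \<omega> l + eps \<tau> l \<omega>" for \<omega> \<tau>
  let ?p = "\<lambda>\<omega> \<tau>. P \<tau> \<omega> l"
  have p[measurable]: "(\<lambda>\<omega>. P \<tau> \<omega> l) \<in> borel_measurable (history (Suc t))" if "\<tau> \<in> {1..t}" for \<tau>
    using that l sets_past_mono[of events_of_day, OF events_of_day_subset, of \<tau> "Suc t"]
    by (intro measurable_from_subalg[OF _ P]) (auto simp: subalgebra_def)
  have [measurable]: "eps \<tau> l \<in> borel_measurable (history (Suc t))" if "\<tau> \<in> {1..t}" for \<tau>
    using that l by (intro shock_measurable_history) auto
  have [measurable]: "(\<lambda>\<omega>. \<Psi> \<omega> \<tau>) \<in> borel_measurable (history (Suc t))" if "\<tau> \<in> {1..t}" for \<tau>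
    using that unfolding \<Psi>_def by measurable
  have slope[measurable]: "(\<lambda>\<omega>. ls_slope (?p \<omega>) (\<Psi> \<omega>) t) \<in> borel_measurable (history (Suc t))"
    unfolding ls_slope_def by measurable
  have "(\<lambda>\<omega>. ls_intercept (?p \<omega>) (\<Psi> \<omega>) t) \<in> borel_measurable (history (Suc t))"
    unfolding ls_intercept_def by measurable
  then have "(\<lambda>\<omega>. (clip amin amax (ls_intercept (?p \<omega>) (\<Psi> \<omega>) t), clip bmin bmax (ls_slope (?p \<omega>) (\<Psi> \<omega>) t)))
     \<in> borel_measurable (history (Suc t))"
    unfolding clip_def using slope by (intro borel_measurable_Pair) auto
  \<comment> \<open>The first two prices differ at every sample point, so the closed form replaces
    the arbitrary choice everywhere.\<close>
  moreover have "est P t \<omega> l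
      = (clip amin amax (ls_intercept (?p \<omega>) (\<Psi> \<omega>) t), clip bmin bmax (ls_slope (?p \<omega>) (\<Psi> \<omega>) t))"
    if "\<omega> \<in> space (history (Suc t))" for \<omega>
    using ls_raw_eq(1)[of t "?p \<omega>" "\<Psi> \<omega>"] first_prices_differ[OF l] that False t l
    by (simp add: nrps_est_def est_link_def Let_def \<Psi>_def[abs_def])
  ultimately show ?thesis by (subst measurable_cong) auto
qed

text \<open>Strong induction: the price of day \<open>d\<close> uses an estimate of even index below
  \<open>d\<close>, which depends on earlier prices and shocks only. Evenness keeps the degenerate
  index 1 out.\<close>

lemma price_measurable_history:
  "1 \<le> d \<Longrightarrow> l \<in> links \<Longrightarrow> (\<lambda>\<omega>. P d \<omega> l) \<in> borel_measurable (history d)"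
proof (induction d arbitrary: l rule: less_induct)
  case (less d)
  define t where "t = (if odd d then d - 1 else d - 2)"
  have t: "even t" "t < d" using less.prems(1) by (auto simp: t_def)
  have "(\<lambda>\<omega>. est P t \<omega> l) \<in> borel_measurable (history d)" if "l \<in> links" for l
  proof -
    have "(\<lambda>\<omega>. est P t \<omega> l) \<in> borel_measurable (history (Suc t))"
      using t that less.IH by (intro est_measurable_history) auto
    moreover have "sets (history (Suc t)) \<subseteq> sets (history d)"
      using t by (intro sets_past_mono events_of_day_subset) auto
    ultimately show ?thesis by (intro measurable_from_subalg[of "history d" "history (Suc t)"]) (auto simp: subalgebra_def)
  qed
  note est = this
  have "(\<lambda>\<omega>. \<lambda>l\<in>links. est P t \<omega> l) \<in> measurable (history d) (PiM links (\<lambda>_. borel))"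
    using est by (intro measurable_restrict)
  \<comment> \<open>The estimate is undefined off \<open>links\<close> by construction, so it is a
    point of the product space on which \<open>popt\<close> is measurable.\<close>
  moreover have "(\<lambda>l\<in>links. est P t \<omega> l) = est P t \<omega>" for \<omega>
    by (auto simp: nrps_est_def)
  ultimately have popt: "(\<lambda>\<omega>. popt (est P t \<omega>) l) \<in> borel_measurable (history d)"
    using measurable_compose[OF _ opt_meas[rule_format, OF less.prems(2)]] by simp
  have "(\<lambda>\<omega>. snd (est P t \<omega> l)) \<in> borel_measurable (history d)"
    using est[OF less.prems(2)] by (rule measurable_compose) (intro borel_measurable_continuous_onI continuous_intros)
  with popt have even: "(\<lambda>\<omega>. popt (est P t \<omega>) l - rho / snd (est P t \<omega> l) * real d powr (- eta))
      \<in> borel_measurable (history d)"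
    by simp
  show ?case
  proof (cases "odd d")
    case True
    then show ?thesis
      using popt price_odd[of d l] less.prems by (subst measurable_cong[where g = "\<lambda>\<omega>. popt (est P t \<omega>) l"]) (auto simp: t_def)
  next
    case False
    then show ?thesis
      using even price_even[of d l] less.prems
      by (subst measurable_cong[where g = "\<lambda>\<omega>. popt (est P t \<omega>) l - rho / snd (est P t \<omega> l) * real d powr (- eta)"])
        (auto simp: t_def)
  qed
qed

text \<open>The guaranteed gap is \<open>rho / bmax\<close> and the price bound
  \<open>K0 + rho / bmin\<close>. With a nonnegative integral, pointwise domination by the
  integrable energy suffices.\<close>

lemma est_error_le:
  assumes t: "2 \<le> t" and l: "l \<in> links"
  defines "K \<equiv> K0 + rho / bmin"
  defines "C \<equiv> 2 + (2 * K\<^sup>2 + 1) * 6 / (rho / bmax)\<^sup>2"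
  shows "(\<integral>\<^sup>+\<omega>. ennreal ((norm (est P t \<omega> l - theta l))\<^sup>2) \<partial>M)
    \<le> ennreal (4 * C * (1 + C) * (shock_bound\<^sup>2 * (3 + ln (1 + K\<^sup>2) / ln 2)) * ln (real t) / real t powr (1 - 2 * eta))"
proof -
  let ?Q = "\<lambda>\<omega>. ridge_energy (\<lambda>\<tau>. P \<tau> \<omega> l) (\<lambda>\<tau>. eps \<tau> l \<omega>) t"
  define A where "A = 4 * C * (1 + C) / real t powr (1 - 2 * eta)"
  have "0 \<le> C" unfolding C_def by (intro add_nonneg_nonneg) auto
  then have A: "0 \<le> A" unfolding A_def by simp
  have sub: "subalgebra M (history t)" for t by (rule subalgebra_past[OF events_of_day_subset])
  have mono: "s \<le> t \<Longrightarrow> sets (history s) \<subseteq> sets (history t)" for s t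
    by (rule sets_past_mono[OF events_of_day_subset])
  have shock: "eps t l \<in> borel_measurable (history (Suc t))" if "1 \<le> t" for t
    using that l by (intro shock_measurable_history) auto
  have price: "\<bar>P d \<omega> l\<bar> \<le> K" if "1 \<le> d" "\<omega> \<in> space M" for d \<omega>
    unfolding K_def by (rule price_abs_le[OF that(1) l that(2)])
  have Q: "integrable M ?Q"
    by (rule expectation_ridge_energy_le(1)[where F = history and K = K and B = shock_bound])
      (fact sub mono price_measurable_history[OF _ l] price shock shock_abs_le[OF _ l] shock_orthogonal[OF _ l] t)+
  have Q_le: "expectation ?Q \<le> shock_bound\<^sup>2 * (3 + ln (1 + K\<^sup>2) / ln 2) * ln (real t)"
    by (rule expectation_ridge_energy_le(2)[where F = history and K = K and B = shock_bound])
      (fact sub mono price_measurable_history[OF _ l] price shock shock_abs_le[OF _ l] shock_orthogonal[OF _ l] t)+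
  have "(\<integral>\<^sup>+\<omega>. ennreal ((norm (est P t \<omega> l - theta l))\<^sup>2) \<partial>M) \<le> (\<integral>\<^sup>+\<omega>. ennreal (A * ?Q \<omega>) \<partial>M)"
  proof (intro nn_integral_mono ennreal_leI)
    fix \<omega> assume \<omega>: "\<omega> \<in> space M"
    have "(norm (est_link amin amax bmin bmax (theta l) (theta0 \<omega> l) (\<lambda>\<tau>. P \<tau> \<omega> l) (\<lambda>\<tau>. eps \<tau> l \<omega>) t - theta l))\<^sup>2
      \<le> 4 * C * (1 + C) * ?Q \<omega> / real t powr (1 - 2 * eta)"
      unfolding C_def
    proof (rule est_link_error_le[OF t _ eta])
      show "0 < rho / bmax" using rho bounds by simp
      show "theta l \<in> {amin..amax} \<times> {bmin..bmax}" using theta_box l by blast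
      show "\<bar>P \<tau> \<omega> l\<bar> \<le> K" if "1 \<le> \<tau>" for \<tau>
        unfolding K_def by (rule price_abs_le[OF that l \<omega>])
      show "rho / bmax * real (2 * k) powr (- eta) \<le> \<bar>P (2 * k - 1) \<omega> l - P (2 * k) \<omega> l\<bar>" if "1 \<le> k" for k
        by (rule price_gap[OF that l \<omega>])
    qed
    then show "(norm (est P t \<omega> l - theta l))\<^sup>2 \<le> A * ?Q \<omega>"
      using l by (simp add: nrps_est_def A_def)
  qed
  also have "\<dots> = ennreal (expectation (\<lambda>\<omega>. A * ?Q \<omega>))"
    using Q A by (intro nn_integral_eq_integral) (auto intro!: AE_I2 mult_nonneg_nonneg ridge_energy_nonneg)
  also have "\<dots> \<le> ennreal (A * (shock_bound\<^sup>2 * (3 + ln (1 + K\<^sup>2) / ln 2) * ln (real t)))"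
    using Q_le A by (intro ennreal_leI) (simp add: mult_left_mono)
  also have "A * (shock_bound\<^sup>2 * (3 + ln (1 + K\<^sup>2) / ln 2) * ln (real t))
     = 4 * C * (1 + C) * (shock_bound\<^sup>2 * (3 + ln (1 + K\<^sup>2) / ln 2)) * ln (real t) / real t powr (1 - 2 * eta)"
    by (simp add: A_def)
  finally show ?thesis .
qed

end

end

theorem theorem1:
  fixes M :: "'a measure"
    and theta :: "'loc::finite \<times> 'loc \<Rightarrow> real \<times> real"
    and xi :: "'loc \<times> 'loc \<Rightarrow> real"
    and c pmax amin amax bmin bmax elo ehi :: real
    and D :: "'loc \<times> 'loc \<Rightarrow> real measure"
    and eps :: "nat \<Rightarrow> 'loc \<times> 'loc \<Rightarrow> 'a \<Rightarrow> real"
    and theta0 :: "'a \<Rightarrow> 'loc \<times> 'loc \<Rightarrow> real \<times> real"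
    and popt wopt :: "('loc \<times> 'loc \<Rightarrow> real \<times> real) \<Rightarrow> 'loc \<times> 'loc \<Rightarrow> real"
  assumes M: "prob_space M"
    and bounds: "0 < amin" "amin \<le> amax" "0 < bmin" "bmin \<le> bmax"
    and theta_box: "\<forall>l\<in>links. theta l \<in> {amin..amax} \<times> {bmin..bmax}"
    and xi_pos: "\<forall>l\<in>links. 0 < xi l"
    and cost: "0 < c" "c < pmax"
    and nonneg_demand: "amin - bmax * pmax + elo \<ge> 0"
    and shocks: "\<forall>d\<ge>1. \<forall>l\<in>links. eps d l \<in> borel_measurable M \<and>
                   (\<forall>\<omega>\<in>space M. eps d l \<omega> \<in> {elo..ehi}) \<and> distr M borel (eps d l) = D l"
    and shock_mean: "\<forall>l\<in>links. (\<integral>x. x \<partial>(D l)) = 0"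
    and shocks_indep: "prob_space.indep_vars M (\<lambda>_. PiM links (\<lambda>_. borel))
                          (\<lambda>d \<omega>. \<lambda>l\<in>links. eps d l \<omega>) {1..}"
    and init_box: "\<forall>\<omega>\<in>space M. \<forall>l\<in>links. theta0 \<omega> l \<in> {amin..amax} \<times> {bmin..bmax}"
    and init_rv: "(\<lambda>\<omega>. \<lambda>l\<in>links. theta0 \<omega> l) \<in> measurable M (PiM links (\<lambda>_. borel))"
    and init_indep: "prob_space.indep_set M
        {(\<lambda>\<omega>. \<lambda>l\<in>links. theta0 \<omega> l) -` A \<inter> space M | A. A \<in> sets (PiM links (\<lambda>_. borel))}
        {(\<lambda>\<omega>. \<lambda>d\<in>{1..}. \<lambda>l\<in>links. eps d l \<omega>) -` A \<inter> space M
           | A. A \<in> sets (PiM {1..} (\<lambda>_. PiM links (\<lambda>_. borel)))}"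
    and opt_sel: "\<forall>thh. (\<forall>l\<in>links. thh l \<in> {amin..amax} \<times> {bmin..bmax}) \<longrightarrow>
                     optimal xi c pmax D thh (popt thh) (wopt thh)"
    and opt_meas: "\<forall>l\<in>links. (\<lambda>thh. popt thh l) \<in> borel_measurable (PiM links (\<lambda>_. borel))"
  shows "(\<exists>Phi1 :: real \<Rightarrow> real \<Rightarrow> real.
            (\<forall>rho eta. 0 < rho \<and> 0 < eta \<and> eta < 1/2 \<longrightarrow> 0 < Phi1 rho eta) \<and>
            (\<forall>rho eta P W. 0 < rho \<longrightarrow> 0 < eta \<longrightarrow> eta < 1/2 \<longrightarrow>
               nrps_policy M amin amax bmin bmax theta theta0 eps popt wopt rho eta P W \<longrightarrow>
               (\<forall>d l. 5 \<le> d \<and> l \<in> links \<longrightarrow>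
                  (\<integral>\<^sup>+\<omega>. ennreal ((norm (nrps_est amin amax bmin bmax theta theta0 eps P (d - 1) \<omega> l
                                          - theta l))\<^sup>2) \<partial>M)
                  < ennreal (Phi1 rho eta * ln (real (d - 1)) / real (d - 1) powr (1 - 2 * eta)))))
         \<and> (\<forall>rho eta P W. 0 < rho \<longrightarrow> 0 < eta \<longrightarrow> eta < 1/2 \<longrightarrow>
               nrps_policy M amin amax bmin bmax theta theta0 eps popt wopt rho eta P W \<longrightarrow>
               (\<forall>l\<in>links.
                  (\<lambda>d. \<integral>\<^sup>+\<omega>. ennreal ((norm (nrps_est amin amax bmin bmax theta theta0 eps P (d - 1) \<omega> l
                                            - theta l))\<^sup>2) \<partial>M) \<longlonglongrightarrow> 0))"
proof -
  interpret prob_space M by (rule M)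
  interpret nrps_model M theta xi c pmax amin amax bmin bmax elo ehi D eps theta0 popt wopt
    by unfold_locales (rule bounds theta_box xi_pos cost shocks shock_mean shocks_indep
        init_box init_rv init_indep opt_sel opt_meas)+
  \<comment> \<open>Chosen before the parameters and the run, so the constants below depend on
    neither the prices nor the day.\<close>
  obtain K0 where K0: "\<And>thh l. (\<forall>l\<in>links. thh l \<in> {amin..amax} \<times> {bmin..bmax}) \<Longrightarrow> l \<in> links \<Longrightarrow> \<bar>popt thh l\<bar> \<le> K0"
    using popt_bounded by blast
  define K where "K rho = K0 + rho / bmin" for rho
  define C where "C rho = 2 + (2 * (K rho)\<^sup>2 + 1) * 6 / (rho / bmax)\<^sup>2" for rho
  define A where "A rho = 4 * C rho * (1 + C rho) * (shock_bound\<^sup>2 * (3 + ln (1 + (K rho)\<^sup>2) / ln 2))" for rho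
  \<comment> \<open>The added 1 keeps the value positive and the inequality strict even if
    \<open>A rho\<close> is zero, as when the shocks vanish.\<close>
  define \<Phi> where "\<Phi> rho (eta :: real) = 1 + A rho" for rho eta
  have C: "0 \<le> C rho" for rho unfolding C_def by (intro add_nonneg_nonneg) auto
  have A: "0 \<le> A rho" for rho
    unfolding A_def using C[of rho] by (intro mult_nonneg_nonneg add_nonneg_nonneg) auto
  have rate: "(\<integral>\<^sup>+\<omega>. ennreal ((norm (est P t \<omega> l - theta l))\<^sup>2) \<partial>M)
      < ennreal (\<Phi> rho eta * ln (real t) / real t powr (1 - 2 * eta))"
    if run: "0 < rho" "0 < eta" "eta < 1 / 2"
        "nrps_policy M amin amax bmin bmax theta theta0 eps popt wopt rho eta P W"
      and t: "2 \<le> t" and l: "l \<in> links" for rho eta P W t l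
  proof -
    have "(\<integral>\<^sup>+\<omega>. ennreal ((norm (est P t \<omega> l - theta l))\<^sup>2) \<partial>M)
        \<le> ennreal (A rho * ln (real t) / real t powr (1 - 2 * eta))"
      unfolding A_def C_def K_def by (rule est_error_le[OF run K0 t l])
    also have "\<dots> < ennreal (\<Phi> rho eta * ln (real t) / real t powr (1 - 2 * eta))"
      unfolding \<Phi>_def using t A[of rho]
      by (intro ennreal_lessI divide_strict_right_mono mult_strict_right_mono divide_pos_pos mult_pos_pos) auto
    finally show ?thesis .
  qed
  have limit: "(\<lambda>d. \<integral>\<^sup>+\<omega>. ennreal ((norm (est P (d - 1) \<omega> l - theta l))\<^sup>2) \<partial>M) \<longlonglongrightarrow> 0"
    if run: "0 < rho" "0 < eta" "eta < 1 / 2"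
        "nrps_policy M amin amax bmin bmax theta theta0 eps popt wopt rho eta P W"
      and l: "l \<in> links" for rho eta P W l
  proof (rule tendsto_sandwich[where f = "\<lambda>_. 0"])
    let ?b = "\<lambda>t. \<Phi> rho eta * ln (real t) / real t powr (1 - 2 * eta)"
    \<comment> \<open>The exponent \<open>1 - 2 * eta\<close> is positive because \<open>eta\<close>
      is below one half, so the power beats the logarithm.\<close>
    have "(\<lambda>t. \<Phi> rho eta * (ln (real t) / real t powr (1 - 2 * eta))) \<longlonglongrightarrow> \<Phi> rho eta * 0"
      using run by (intro tendsto_mult tendsto_const lim_ln_over_power) auto
    then have "?b \<longlonglongrightarrow> 0" by simp
    then have "(\<lambda>d. ?b (d - 1)) \<longlonglongrightarrow> 0"
      by (rule filterlim_compose) (rule filterlim_minus_const_nat_at_top)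
    then have "(\<lambda>d. ennreal (?b (d - 1))) \<longlonglongrightarrow> ennreal 0" by (rule tendsto_ennrealI)
    then show "(\<lambda>d. ennreal (?b (d - 1))) \<longlonglongrightarrow> 0" by simp
    show "\<forall>\<^sub>F d in sequentially. (\<integral>\<^sup>+\<omega>. ennreal ((norm (est P (d - 1) \<omega> l - theta l))\<^sup>2) \<partial>M)
        \<le> ennreal (?b (d - 1))"
      using eventually_ge_at_top[of 3]
    proof eventually_elim
      case (elim d)
      then have "2 \<le> d - 1" by simp
      from rate[OF run this l] show ?case by (rule less_imp_le)
    qed
  qed auto
  show ?thesis
  proof (intro conjI exI[of _ \<Phi>] allI impI ballI)
    show "0 < \<Phi> rho eta" for rho eta
      unfolding \<Phi>_def using A[of rho] by simp
  next
    fix rho eta :: real and P W and d :: nat and l :: "'loc \<times> 'loc"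
    assume run: "0 < rho" "0 < eta" "eta < 1 / 2"
      "nrps_policy M amin amax bmin bmax theta theta0 eps popt wopt rho eta P W" and "5 \<le> d \<and> l \<in> links"
    then show "(\<integral>\<^sup>+\<omega>. ennreal ((norm (est P (d - 1) \<omega> l - theta l))\<^sup>2) \<partial>M)
        < ennreal (\<Phi> rho eta * ln (real (d - 1)) / real (d - 1) powr (1 - 2 * eta))"
      by (intro rate[OF run]) auto
  qed (rule limit)
qed

end
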